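(* Let $R$ be a Prüfer domain and suppose that $R$ is either (a) semilocal; or (b) locally finite and finite-dimensional. Then every stable star operation $\ast$ on $R$ is of the form $$I\mapsto\bigcap_{P\in\mathrm{Max}(R)}(IR_P)^{\ast^{(P)}},$$ where each $\ast^{(P)}\in\mathrm{Star}(R_P)$. In particular, $\mathrm{Star}_{st}(R)$ is order-isomorphic to $\prod\{\mathrm{Star}(R_P)\mid P\in\mathrm{Max}(R)\}$.
   Context: For an integral domain $R$ with quotient field $K$, $\mathcal{F}(R)$ is the set of fractional ideals of $R$ (the $R$-submodules $I$ of $K$ with $dI\subseteq R$ for some nonzero $d\in R$). A star operation on $R$ is a map $\ast:\mathcal{F}(R)\to\mathcal{F}(R)$, $I\mapsto I^\ast$, such that for all $I,J\in\mathcal{F}(R)$, $x\in K$: $I\subseteq I^\ast$; $(I^\ast)^\ast=I^\ast$; $I\subseteq J$ implies $I^\ast\subseteq J^\ast$; $R^\ast=R$; $(xI)^\ast=xI^\ast$. $\mathrm{Star}(R)$ is the set of star operations on $R$, ordered by $\ast_1\leq\ast_2$ iff $I^{\ast_1}\subseteq I^{\ast_2}$ for all $I$; products carry the componentwise order. A star operation is stable if $(I\cap J)^\ast=I^\ast\cap J^\ast$ for all ideals $I,J$; $\mathrm{Star}_{st}(R)\subseteq\mathrm{Star}(R)$ is the ordered subset of stable star operations. $R$ is locally finite (of finite character) if every nonzero $x\in R$ is contained in only finitely many maximal ideals of $R$; semilocal means having finitely many maximal ideals. *)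

theory Defs
  imports
    "HOL-Algebra.Algebraic_Closure_Type"
    "HOL-Algebra.Subrings"
    "HOL-Algebra.Ideal_Product"
    "HOL-Algebra.Module"
    "HOL-Library.Extended_Nat"
    "HOL-Library.FuncSet"
begin

text \<open>
  An integral domain \<open>R\<close> is given as a subring of its quotient field \<open>K\<close>, where \<open>K\<close> is the
  universe of a type \<open>'a::field\<close>. The localizations of \<open>R\<close> are then subrings of the same \<open>K\<close>,
  and fractional ideals of any of these rings are subsets of \<open>K\<close>.
\<close>

abbreviation quot_field :: "'a::field ring" where
  "quot_field \<equiv> ring_of_type_algebra"

abbreviation ring_on :: "'a::field set \<Rightarrow> 'a ring" where
  "ring_on R \<equiv> quot_field\<lparr>carrier := R\<rparr>"

text \<open>\<open>K\<close> as a module; the scalars of the ring acting on it are supplied by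
  the second argument of \<^const>\<open>submodule\<close>.\<close>

definition quot_field_module :: "('a, 'a::field) module" where
  "quot_field_module =
     \<lparr>carrier = UNIV, monoid.mult = (*), one = 1, ring.zero = 0, add = (+), module.smult = (*)\<rparr>"

definition domain_with_quotient_field :: "'a::field set \<Rightarrow> bool" where
  "domain_with_quotient_field R \<longleftrightarrow>
     subdomain R quot_field \<and> (\<forall>x. \<exists>a\<in>R. \<exists>b\<in>R. b \<noteq> 0 \<and> x = a / b)"

definition max_ideals :: "'a::field set \<Rightarrow> 'a set set" where
  "max_ideals R = {P. maximalideal P (ring_on R)}"

definition prime_ideals :: "'a::field set \<Rightarrow> 'a set set" where
  "prime_ideals R = {P. primeideal P (ring_on R)}"

definition semilocal :: "'a::field set \<Rightarrow> bool" where
  "semilocal R \<longleftrightarrow> finite (max_ideals R)"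

definition locally_finite :: "'a::field set \<Rightarrow> bool" where
  "locally_finite R \<longleftrightarrow> (\<forall>x\<in>R. x \<noteq> 0 \<longrightarrow> finite {P \<in> max_ideals R. x \<in> P})"

text \<open>A chain of \<open>n + 1\<close> primes has length \<open>n\<close>.\<close>

definition krull_dim :: "'a::field set \<Rightarrow> enat" where
  "krull_dim R =
     Sup {enat (card C - 1) | C. C \<in> chains (prime_ideals R) \<and> finite C \<and> C \<noteq> {}}"

definition finite_dimensional :: "'a::field set \<Rightarrow> bool" where
  "finite_dimensional R \<longleftrightarrow> krull_dim R < \<infinity>"

definition fractional_ideals :: "'a::field set \<Rightarrow> 'a set set" where
  "fractional_ideals R =
     {I. submodule I (ring_on R) quot_field_module \<and> (\<exists>d\<in>R. d \<noteq> 0 \<and> (\<forall>x\<in>I. d * x \<in> R))}"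

definition invertible_ideal :: "'a::field set \<Rightarrow> 'a set \<Rightarrow> bool" where
  "invertible_ideal R I \<longleftrightarrow> (\<exists>J\<in>fractional_ideals R. ideal_prod quot_field I J = R)"

definition prufer_domain :: "'a::field set \<Rightarrow> bool" where
  "prufer_domain R \<longleftrightarrow>
     domain_with_quotient_field R \<and>
     (\<forall>S. finite S \<and> S \<subseteq> R \<and> Idl\<^bsub>ring_on R\<^esub> S \<noteq> {0} \<longrightarrow>
        invertible_ideal R (Idl\<^bsub>ring_on R\<^esub> S))"

definition localization :: "'a::field set \<Rightarrow> 'a set \<Rightarrow> 'a set" where
  "localization R P = {a / s | a s. a \<in> R \<and> s \<in> R \<and> s \<notin> P}"

text \<open>Star operations are maps on the set of fractional ideals only, so they are taken to be
  \<^const>\<open>undefined\<close> elsewhere; distinct elements of \<open>Star R\<close> thus differ on some fractional ideal.\<close>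

definition Star :: "'a::field set \<Rightarrow> ('a set \<Rightarrow> 'a set) set" where
  "Star R = {st \<in> fractional_ideals R \<rightarrow>\<^sub>E fractional_ideals R.
     (\<forall>I\<in>fractional_ideals R. I \<subseteq> st I) \<and>
     (\<forall>I\<in>fractional_ideals R. st (st I) = st I) \<and>
     (\<forall>I\<in>fractional_ideals R. \<forall>J\<in>fractional_ideals R. I \<subseteq> J \<longrightarrow> st I \<subseteq> st J) \<and>
     st R = R \<and>
     (\<forall>I\<in>fractional_ideals R. \<forall>x. st ((*) x ` I) = (*) x ` st I)}"

definition star_le :: "'a::field set \<Rightarrow> ('a set \<Rightarrow> 'a set) \<Rightarrow> ('a set \<Rightarrow> 'a set) \<Rightarrow> bool" where
  "star_le R st1 st2 \<longleftrightarrow> (\<forall>I\<in>fractional_ideals R. st1 I \<subseteq> st2 I)"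

definition stable :: "'a::field set \<Rightarrow> ('a set \<Rightarrow> 'a set) \<Rightarrow> bool" where
  "stable R st \<longleftrightarrow>
     (\<forall>I J. ideal I (ring_on R) \<and> ideal J (ring_on R) \<longrightarrow> st (I \<inter> J) = st I \<inter> st J)"

definition Star_st :: "'a::field set \<Rightarrow> ('a set \<Rightarrow> 'a set) set" where
  "Star_st R = {st \<in> Star R. stable R st}"

definition local_star_product :: "'a::field set \<Rightarrow> ('a set \<Rightarrow> 'a set \<Rightarrow> 'a set) set" where
  "local_star_product R = (\<Pi>\<^sub>E P\<in>max_ideals R. Star (localization R P))"

definition local_star_product_le ::
  "'a::field set \<Rightarrow> ('a set \<Rightarrow> 'a set \<Rightarrow> 'a set) \<Rightarrow> ('a set \<Rightarrow> 'a set \<Rightarrow> 'a set) \<Rightarrow> bool" where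
  "local_star_product_le R f g \<longleftrightarrow>
     (\<forall>P\<in>max_ideals R. star_le (localization R P) (f P) (g P))"

definition order_isomorphic ::
  "'b set \<Rightarrow> ('b \<Rightarrow> 'b \<Rightarrow> bool) \<Rightarrow> 'c set \<Rightarrow> ('c \<Rightarrow> 'c \<Rightarrow> bool) \<Rightarrow> bool" where
  "order_isomorphic A leA B leB \<longleftrightarrow>
     (\<exists>h. bij_betw h A B \<and> (\<forall>x\<in>A. \<forall>y\<in>A. leA x y \<longleftrightarrow> leB (h x) (h y)))"

end

theory Submission
  imports Defs
begin

text \<open>
  On a valuation domain \<open>V\<close> with maximal ideal \<open>M\<close> a star operation can only enlarge an ideal \<open>A\<close>
  to \<open>(A : M)\<close>, and it does so for every \<open>A\<close> as soon as \<open>1 \<in> M\<^sup>*\<close>. A family of star operations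
  on the rings \<open>R\<^sub>P\<close> is therefore determined by the maximal ideals \<open>P\<close> at which \<open>1\<close> lies in the
  closure of \<open>P R\<^sub>P\<close>, and this set is read off the glued operation by evaluating it at the \<open>P\<close>.

  Conversely, stability gives \<open>x \<in> I\<^sup>*\<close> iff \<open>1 \<in> A\<^sup>*\<close> for \<open>A = (I :\<^sub>R x)\<close>. If \<open>1 \<in> A\<^sup>*\<close> and \<open>A \<subseteq> P\<close>,
  then \<open>A R\<^sub>P = P R\<^sub>P\<close>: otherwise \<open>A\<close> lies in a proper ideal \<open>x R\<^sub>P \<inter> R\<close> that is contained in no
  maximal ideal but \<open>P\<close>, and by local finiteness such an ideal is invertible, hence closed. So
  \<open>1 \<in> A\<^sup>*\<close> means that \<open>A\<close> contains a finite intersection of maximal ideals \<open>P\<close> with \<open>1 \<in> P\<^sup>*\<close>,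
  which is a condition on the localizations of \<open>A\<close>.
\<close>

section \<open>Domains inside their quotient field\<close>

text \<open>Closure conditions on a bare subset of the field, so that the same facts can be
  instantiated at \<open>R\<close> and at every localization \<open>loc P R\<close>.\<close>

locale frac_domain =
  fixes R :: "'a::field set"
  assumes zero_mem: "0 \<in> R"
    and one_mem: "1 \<in> R"
    and add_mem: "x \<in> R \<Longrightarrow> y \<in> R \<Longrightarrow> x + y \<in> R"
    and mult_mem: "x \<in> R \<Longrightarrow> y \<in> R \<Longrightarrow> x * y \<in> R"
    and uminus_mem: "x \<in> R \<Longrightarrow> - x \<in> R"
    and quotient: "\<exists>a\<in>R. \<exists>b\<in>R. b \<noteq> 0 \<and> x = a / b"

section \<open>Library modules and ideals in elementary terms\<close>

lemma mem_scale_iff: "x \<noteq> 0 \<Longrightarrow> y \<in> (*) x ` B \<longleftrightarrow> y / x \<in> B" for x y :: "'a::field"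
  by (auto simp: image_iff intro!: bexI[of _ "y / x"])

lemma inv_quot_field_module: "inv\<^bsub>add_monoid quot_field_module\<^esub> x = - (x::'a::field)"
  unfolding m_inv_def quot_field_module_def
  by (rule the_equality) (auto simp: eq_neg_iff_add_eq_0 add.commute)

lemma frac_domainI:
  assumes "domain_with_quotient_field R"
  shows "frac_domain R"
proof -
  have sub: "subdomain R (quot_field :: 'a ring)"
    and q: "\<And>x. \<exists>a\<in>R. \<exists>b\<in>R. b \<noteq> 0 \<and> x = a / b"
    using assms unfolding domain_with_quotient_field_def by auto
  interpret K: ring "quot_field :: 'a ring" by (rule ring_from_type_algebra)
  interpret S: subdomain R "quot_field :: 'a ring" by (rule sub)
  have inv: "inv\<^bsub>add_monoid quot_field\<^esub> x = - x" for x :: 'a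
    unfolding m_inv_def ring_of_type_algebra_def
    by (rule the_equality) (auto simp: eq_neg_iff_add_eq_0 add.commute)
  show ?thesis
  proof
    show "0 \<in> R" "1 \<in> R"
      using subgroup.one_closed[OF S.subgroup_axioms] S.one_closed
      by (auto simp: ring_of_type_algebra_def)
    show "x + y \<in> R" "x * y \<in> R" if "x \<in> R" "y \<in> R" for x y
      using that subgroup.m_closed[OF S.subgroup_axioms, of x y] S.m_closed[of x y]
      by (auto simp: ring_of_type_algebra_def)
    show "- x \<in> R" if "x \<in> R" for x
      using S.m_inv_closed[OF that] inv[of x] by simp
  qed (rule q)
qed

context frac_domain
begin

lemma submodule_iff:
  "submodule I (ring_on R) quot_field_module \<longleftrightarrow>
    0 \<in> I \<and> (\<forall>x\<in>I. \<forall>y\<in>I. x + y \<in> I) \<and> (\<forall>r\<in>R. \<forall>x\<in>I. r * x \<in> I)" (is "?L \<longleftrightarrow> ?R")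
proof
  assume ?L
  then interpret submodule I "ring_on R" quot_field_module .
  show ?R
    using one_closed m_closed smult_closed by (auto simp: quot_field_module_def)
next
  assume r: ?R
  have m: "- x \<in> I" if "x \<in> I" for x
  proof -
    have "(- 1) * x \<in> I" using r that uminus_mem[OF one_mem] by blast
    then show ?thesis by simp
  qed
  have "subgroup I (add_monoid quot_field_module)"
    by (rule subgroup.intro)
      (use r m in \<open>auto simp: inv_quot_field_module, auto simp: quot_field_module_def\<close>)
  then show ?L
    by (rule submodule.intro)
      (use r in \<open>auto simp: submodule_axioms_def quot_field_module_def\<close>)
qed

lemma fractional_iff:
  "I \<in> fractional_ideals R \<longleftrightarrow>
    0 \<in> I \<and> (\<forall>x\<in>I. \<forall>y\<in>I. x + y \<in> I) \<and> (\<forall>r\<in>R. \<forall>x\<in>I. r * x \<in> I)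
    \<and> (\<exists>d\<in>R. d \<noteq> 0 \<and> (\<forall>x\<in>I. d * x \<in> R))"
  unfolding fractional_ideals_def submodule_iff by blast

lemma fractionalI:
  assumes "0 \<in> I" "\<And>x y. x \<in> I \<Longrightarrow> y \<in> I \<Longrightarrow> x + y \<in> I"
    "\<And>r x. r \<in> R \<Longrightarrow> x \<in> I \<Longrightarrow> r * x \<in> I"
    "d \<in> R" "d \<noteq> 0" "\<And>x. x \<in> I \<Longrightarrow> d * x \<in> R"
  shows "I \<in> fractional_ideals R"
  using assms unfolding fractional_iff by blast

lemma
  assumes "I \<in> fractional_ideals R"
  shows frac_zero: "0 \<in> I"
    and frac_add: "\<And>x y. x \<in> I \<Longrightarrow> y \<in> I \<Longrightarrow> x + y \<in> I"
    and frac_mult: "\<And>r x. r \<in> R \<Longrightarrow> x \<in> I \<Longrightarrow> r * x \<in> I"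
    and frac_denom: "\<exists>d\<in>R. d \<noteq> 0 \<and> (\<forall>x\<in>I. d * x \<in> R)"
  using assms unfolding fractional_iff by blast+

lemma frac_self: "R \<in> fractional_ideals R"
  by (rule fractionalI[of _ 1]) (auto simp: zero_mem one_mem add_mem mult_mem)

lemma frac_scale:
  assumes "I \<in> fractional_ideals R"
  shows "(*) x ` I \<in> fractional_ideals R"
proof -
  obtain d where d: "d \<in> R" "d \<noteq> 0" "\<And>x. x \<in> I \<Longrightarrow> d * x \<in> R"
    using frac_denom[OF assms] by blast
  obtain a b where ab: "a \<in> R" "b \<in> R" "b \<noteq> 0" "x = a / b"
    using quotient by blast
  show ?thesis
  proof (rule fractionalI[of _ "d * b"])
    show "0 \<in> (*) x ` I" using frac_zero[OF assms] by force
    show "y + z \<in> (*) x ` I" if "y \<in> (*) x ` I" "z \<in> (*) x ` I" for y z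
      using that frac_add[OF assms] by (auto simp flip: distrib_left)
    show "r * y \<in> (*) x ` I" if "r \<in> R" "y \<in> (*) x ` I" for r y
      using that frac_mult[OF assms, of r] by (auto simp: mult.left_commute)
    show "d * b * y \<in> R" if y: "y \<in> (*) x ` I" for y
    proof -
      obtain i where i: "i \<in> I" "y = x * i" using y by blast
      have "d * b * y = a * (d * i)" using i ab by simp
      then show ?thesis using mult_mem[OF ab(1) d(3)[OF i(1)]] by (rule ssubst)
    qed
  qed (use d ab mult_mem in auto)
qed

lemma frac_Int:
  assumes "I \<in> fractional_ideals R" "J \<in> fractional_ideals R"
  shows "I \<inter> J \<in> fractional_ideals R"
  using assms unfolding fractional_iff by blast

lemma inv_ring_on:
  assumes "x \<in> R"
  shows "inv\<^bsub>add_monoid (ring_on R)\<^esub> x = - x"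
  unfolding m_inv_def ring_of_type_algebra_def
  by (rule the_equality)
    (use assms uminus_mem in \<open>auto simp: eq_neg_iff_add_eq_0 add.commute\<close>)

lemma cring_ring_on: "cring (ring_on R)"
proof (rule cringI)
  show "abelian_group (ring_on R)"
  proof (rule abelian_groupI)
    fix x assume "x \<in> carrier (ring_on R)"
    then show "\<exists>y\<in>carrier (ring_on R). y \<oplus>\<^bsub>ring_on R\<^esub> x = \<zero>\<^bsub>ring_on R\<^esub>"
      by (intro bexI[of _ "- x"]) (auto simp: ring_of_type_algebra_def uminus_mem)
  qed (auto simp: ring_of_type_algebra_def zero_mem add_mem algebra_simps)
  show "comm_monoid (ring_on R)"
    by (rule comm_monoidI) (auto simp: ring_of_type_algebra_def one_mem mult_mem algebra_simps)
qed (auto simp: ring_of_type_algebra_def algebra_simps)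

text \<open>Denominator 1 serves for every subset of \<open>R\<close>; from here on integral ideals
  can be handled by the facts on fractional ideals.\<close>

lemma ideal_iff: "ideal I (ring_on R) \<longleftrightarrow> I \<in> fractional_ideals R \<and> I \<subseteq> R" (is "?L \<longleftrightarrow> ?R")
proof
  assume ?L
  then interpret ideal I "ring_on R" .
  have sub: "I \<subseteq> R" using a_subset by simp
  show ?R
  proof
    show "I \<in> fractional_ideals R"
    proof (rule fractionalI[of _ 1])
      show "x + y \<in> I" if "x \<in> I" "y \<in> I" for x y
        using additive_subgroup.a_closed[OF is_additive_subgroup that] by (simp add: ring_of_type_algebra_def)
      show "r * x \<in> I" if "r \<in> R" "x \<in> I" for r x
        using I_l_closed[of x r] that by (simp add: ring_of_type_algebra_def)
    qed (use additive_subgroup.zero_closed[OF is_additive_subgroup] sub one_mem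
           in \<open>auto simp: ring_of_type_algebra_def\<close>)
  qed (rule sub)
next
  assume r: ?R
  have m: "- x \<in> I" if "x \<in> I" for x
    using frac_mult[of I "- 1" x] uminus_mem[OF one_mem] that r by simp
  have sg: "subgroup I (add_monoid (ring_on R))"
  proof (rule subgroup.intro)
    show "inv\<^bsub>add_monoid (ring_on R)\<^esub> x \<in> I" if "x \<in> I" for x
      using that r m inv_ring_on[of x] by auto
  qed (use r frac_zero[of I] frac_add[of I] in \<open>auto simp: ring_of_type_algebra_def\<close>)
  interpret cring "ring_on R" by (rule cring_ring_on)
  show ?L
    by (rule idealI[OF ring_axioms sg])
      (use r frac_mult[of I] in \<open>simp_all add: ring_of_type_algebra_def, metis mult.commute\<close>)
qed

section \<open>Maximal ideals: existence, primality, avoidance\<close>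

lemma max_ideals_iff:
  "P \<in> max_ideals R \<longleftrightarrow> P \<in> fractional_ideals R \<and> P \<subseteq> R \<and> 1 \<notin> P \<and>
    (\<forall>J\<in>fractional_ideals R. P \<subseteq> J \<and> J \<subseteq> R \<and> 1 \<notin> J \<longrightarrow> J = P)"
proof -
  have "1 \<notin> J \<longleftrightarrow> J \<noteq> R" if "J \<in> fractional_ideals R" "J \<subseteq> R" for J
    using frac_mult[OF that(1)] that(2) one_mem mult.right_neutral by (metis subsetI subset_antisym)
  then show ?thesis
    unfolding max_ideals_def maximalideal_def maximalideal_axioms_def ideal_iff
    by (auto; metis)
qed

text \<open>Zorn's lemma for the ideals that contain \<open>I\<close> and avoid 1; the union of a
  nonempty chain of such ideals is again one.\<close>

lemma exists_max_ideal:
  assumes I: "I \<in> fractional_ideals R" "I \<subseteq> R" "1 \<notin> I"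
  shows "\<exists>P\<in>max_ideals R. I \<subseteq> P"
proof -
  define A where "A = {J \<in> fractional_ideals R. I \<subseteq> J \<and> J \<subseteq> R \<and> 1 \<notin> J}"
  have "\<exists>M\<in>A. \<forall>U\<in>A. M \<subseteq> U \<longrightarrow> U = M"
  proof (rule subset_Zorn_nonempty)
    show "A \<noteq> {}" using I unfolding A_def by blast
    fix C assume C: "C \<noteq> {}" "subset.chain A C"
    have CA: "C \<subseteq> A" and lin: "\<And>U Y. U \<in> C \<Longrightarrow> Y \<in> C \<Longrightarrow> U \<subseteq> Y \<or> Y \<subseteq> U"
      using C(2) by (auto simp: subset_chain_def)
    have fr: "U \<in> fractional_ideals R" "I \<subseteq> U" "U \<subseteq> R" "1 \<notin> U" if "U \<in> C" for U
      using that CA unfolding A_def by auto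
    have "\<Union>C \<in> fractional_ideals R"
    proof (rule fractionalI[of _ 1])
      show "0 \<in> \<Union>C" using C(1) frac_zero[OF fr(1)] by blast
      show "x + y \<in> \<Union>C" if "x \<in> \<Union>C" "y \<in> \<Union>C" for x y
      proof -
        obtain U Y where UY: "U \<in> C" "Y \<in> C" "x \<in> U" "y \<in> Y" using \<open>x \<in> \<Union>C\<close> \<open>y \<in> \<Union>C\<close> by blast
        then obtain Z where "Z \<in> C" "x \<in> Z" "y \<in> Z" using lin[of U Y] by blast
        then show ?thesis using frac_add[OF fr(1)] by blast
      qed
      show "r * x \<in> \<Union>C" if "r \<in> R" "x \<in> \<Union>C" for r x
        using that frac_mult[OF fr(1)] by blast
      show "1 * x \<in> R" if "x \<in> \<Union>C" for x
        using that fr(3) by auto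
    qed (auto simp: one_mem)
    then show "\<Union>C \<in> A" using C(1) fr unfolding A_def by blast
  qed
  then obtain M where M: "M \<in> A" "\<And>U. U \<in> A \<Longrightarrow> M \<subseteq> U \<Longrightarrow> U = M" by blast
  have "M \<in> max_ideals R"
    unfolding max_ideals_iff using M unfolding A_def by blast
  then show ?thesis using M(1) unfolding A_def by blast
qed

lemma
  assumes "P \<in> max_ideals R"
  shows max_frac: "P \<in> fractional_ideals R" and max_subset: "P \<subseteq> R" and max_one: "1 \<notin> P"
  using assms unfolding max_ideals_iff by auto

text \<open>The ideal P + R x is strictly larger than \<open>P\<close>, so by maximality it contains
  1.\<close>

lemma max_comaximal:
  assumes P: "P \<in> max_ideals R" and x: "x \<in> R" "x \<notin> P"
  shows "\<exists>p\<in>P. \<exists>r\<in>R. 1 = p + r * x"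
proof -
  note fP = max_frac[OF P]
  define J where "J = {p + r * x | p r. p \<in> P \<and> r \<in> R}"
  have "J \<in> fractional_ideals R"
  proof (rule fractionalI[of _ 1])
    show "0 \<in> J" unfolding J_def using frac_zero[OF fP] zero_mem by force
    show "y + z \<in> J" if yz: "y \<in> J" "z \<in> J" for y z
    proof -
      obtain p r p' r' where "y = p + r * x" "z = p' + r' * x" "p \<in> P" "r \<in> R" "p' \<in> P" "r' \<in> R"
        using yz unfolding J_def by blast
      then have "y + z = (p + p') + (r + r') * x" "p + p' \<in> P" "r + r' \<in> R"
        using frac_add[OF fP] add_mem by (auto simp: algebra_simps)
      then show ?thesis unfolding J_def by blast
    qed
    show "s * y \<in> J" if s: "s \<in> R" "y \<in> J" for s y
    proof -
      obtain p r where "y = p + r * x" "p \<in> P" "r \<in> R" using s unfolding J_def by blast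
      then have "s * y = s * p + (s * r) * x" "s * p \<in> P" "s * r \<in> R"
        using frac_mult[OF fP s(1)] mult_mem s by (auto simp: distrib_left mult.assoc)
      then show ?thesis unfolding J_def by blast
    qed
    show "1 * y \<in> R" if "y \<in> J" for y
      using that max_subset[OF P] add_mem mult_mem x unfolding J_def by auto
  qed (auto simp: one_mem)
  moreover have "J \<subseteq> R" using max_subset[OF P] add_mem mult_mem x unfolding J_def by auto
  moreover have "P \<subseteq> J" unfolding J_def using zero_mem by force
  moreover have "x \<in> J" unfolding J_def using frac_zero[OF fP] one_mem by force
  ultimately have "1 \<in> J" using P x(2) unfolding max_ideals_iff by blast
  then show ?thesis unfolding J_def by blast
qed

text \<open>Multiply 1 = p + r x by \<open>y\<close>: if \<open>x * y\<close> were in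
  \<open>P\<close>, so would \<open>y\<close> be.\<close>

lemma max_prime:
  assumes P: "P \<in> max_ideals R" and x: "x \<in> R" "x \<notin> P" and y: "y \<in> R" "y \<notin> P"
  shows "x * y \<notin> P"
proof
  assume xy: "x * y \<in> P"
  obtain p r where pr: "p \<in> P" "r \<in> R" "1 = p + r * x" using max_comaximal[OF P x] by blast
  have "y * (p + r * x) = y * p + r * (x * y)" by (simp add: algebra_simps)
  then have "y = y * p + r * (x * y)" using pr(3) by simp
  moreover have "y * p + r * (x * y) \<in> P"
    using frac_add[OF max_frac[OF P]] frac_mult[OF max_frac[OF P]] pr xy y by blast
  ultimately show False using y by simp
qed

lemma max_not_subset:
  assumes "P \<in> max_ideals R" "Q \<in> max_ideals R" "P \<noteq> Q"
  shows "\<not> P \<subseteq> Q"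
  using assms unfolding max_ideals_iff by blast

text \<open>Each \<open>P\<close> in \<open>F\<close> has an element outside \<open>Q\<close>, as
  distinct maximal ideals are incomparable; the product of these elements avoids \<open>Q\<close> by
  primality.\<close>

lemma element_of_others:
  assumes "finite F" "F \<subseteq> max_ideals R" "Q \<in> max_ideals R" "Q \<notin> F"
  shows "\<exists>t\<in>R. t \<notin> Q \<and> (\<forall>P\<in>F. t \<in> P)"
  using assms
proof (induction F rule: finite_induct)
  case empty
  then show ?case using one_mem max_one by blast
next
  case (insert P F)
  obtain t where t: "t \<in> R" "t \<notin> Q" "\<forall>P\<in>F. t \<in> P" using insert by auto
  obtain p where p: "p \<in> P" "p \<notin> Q" using max_not_subset[of P Q] insert by auto
  have P: "P \<in> max_ideals R" using insert by auto
  have pR: "p \<in> R" using max_subset[OF P] p by auto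
  have "p * t \<in> P'" if P': "P' \<in> insert P F" for P'
  proof -
    have f: "P' \<in> fractional_ideals R" using max_frac P' insert.prems by auto
    show ?thesis
    proof (cases "P' = P")
      case True
      then show ?thesis using frac_mult[OF f t(1), of p] p by (simp add: mult.commute)
    next
      case False
      then show ?thesis using frac_mult[OF f pR, of t] P' t by auto
    qed
  qed
  moreover have "p * t \<notin> Q" using max_prime[OF insert.prems(2) pR p(2) t(1,2)] .
  ultimately show ?case using mult_mem pR t(1) by blast
qed

text \<open>Induction on \<open>F\<close>. An element \<open>c\<close> that falls into the new ideal
  \<open>Q\<close> is corrected by a summand from \<open>J\<close> that lies in every member of
  \<open>F\<close> but not in \<open>Q\<close>.\<close>

lemma prime_avoidance:
  assumes J: "J \<in> fractional_ideals R" "J \<subseteq> R"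
    and F: "finite F" "F \<subseteq> max_ideals R" "\<And>Q. Q \<in> F \<Longrightarrow> \<not> J \<subseteq> Q"
  shows "\<exists>c\<in>J. \<forall>Q\<in>F. c \<notin> Q"
  using F
proof (induction F rule: finite_induct)
  case empty
  then show ?case using frac_zero[OF J(1)] by blast
next
  case (insert Q F)
  obtain c where c: "c \<in> J" "\<And>P. P \<in> F \<Longrightarrow> c \<notin> P" using insert by auto
  have Q: "Q \<in> max_ideals R" using insert by auto
  show ?case
  proof (cases "c \<in> Q")
    case False
    then show ?thesis using c by blast
  next
    case True
    obtain d where d: "d \<in> J" "d \<notin> Q" using insert.prems(2)[of Q] by auto
    obtain t where t: "t \<in> R" "t \<notin> Q" "\<And>P. P \<in> F \<Longrightarrow> t \<in> P"
      using element_of_others[of F Q] insert by auto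
    have dR: "d \<in> R" using d J by auto
    have dt: "d * t \<in> J" using frac_mult[OF J(1) t(1) d(1)] by (simp add: mult.commute)
    have dtQ: "d * t \<notin> Q" using max_prime[OF Q dR d(2) t(1,2)] .
    have diff: "y \<in> P" if P: "P \<in> max_ideals R" "x \<in> P" "x + y \<in> P" for x y P
      using frac_add[OF max_frac[OF P(1)] P(3) frac_mult[OF max_frac[OF P(1)] uminus_mem[OF one_mem] P(2)]]
      by simp
    have "d * t + c \<notin> P" if "P \<in> F" for P
      using diff[of P "d * t" c] frac_mult[OF max_frac, of P d t] that insert.prems t(3) c(2) dR
      by auto
    moreover have "c + d * t \<notin> Q" using diff[OF Q True] dtQ by blast
    ultimately show ?thesis using frac_add[OF J(1) c(1) dt] by (metis add.commute insert_iff)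
  qed
qed


section \<open>Laws of star operations\<close>

lemma
  assumes "st \<in> Star R" "I \<in> fractional_ideals R"
  shows star_frac: "st I \<in> fractional_ideals R"
    and star_extensive: "I \<subseteq> st I"
    and star_idem: "st (st I) = st I"
    and star_mono: "\<And>J. J \<in> fractional_ideals R \<Longrightarrow> I \<subseteq> J \<Longrightarrow> st I \<subseteq> st J"
    and star_scale: "\<And>x. st ((*) x ` I) = (*) x ` st I"
  using assms unfolding Star_def by (auto 0 3 simp: PiE_iff)

lemma star_self: "st \<in> Star R \<Longrightarrow> st R = R"
  unfolding Star_def by blast

lemma star_extensional: "st \<in> Star R \<Longrightarrow> st \<in> extensional (fractional_ideals R)"
  unfolding Star_def by (auto simp: PiE_iff)

text \<open>Equality of the maps, beyond that of their values on fractional ideals, holds because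
  both are \<open>undefined\<close> elsewhere.\<close>

lemma star_le_antisym:
  assumes "s \<in> Star R" "t \<in> Star R" "star_le R s t" "star_le R t s"
  shows "s = t"
  using assms star_extensional unfolding star_le_def
  by (intro extensionalityI[of s "fractional_ideals R" t]) auto

text \<open>In a valuation domain this is the maximal ideal. Zero is listed separately because
  \<open>inverse 0 = 0\<close> lies in \<open>R\<close>.\<close>

definition nonunits :: "'a set" where
  "nonunits = {m \<in> R. m = 0 \<or> inverse m \<notin> R}"

end

section \<open>Star operations on valuation domains\<close>

locale valuation_domain = frac_domain +
  assumes valuation: "x \<in> R \<or> inverse x \<in> R"
begin

text \<open>For sums: one of two nonzero nonunits divides the other, say m/n \<in> R, and then m + n
  = (1 + m/n) n is a multiple of \<open>n\<close>.\<close>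

lemma nonunits_frac: "nonunits \<in> fractional_ideals R"
proof (rule fractionalI[of _ 1])
  show mult: "r * m \<in> nonunits" if "r \<in> R" "m \<in> nonunits" for r m
  proof (cases "r * m = 0")
    case False
    have "r * inverse (r * m) = inverse m" using False by (simp add: field_simps)
    then have "inverse (r * m) \<notin> R"
      using that False mult_mem[of r "inverse (r * m)"] unfolding nonunits_def
      by (auto simp del: inverse_mult_distrib)
    then show ?thesis using that mult_mem[of r m] unfolding nonunits_def by auto
  qed (use that zero_mem in \<open>auto simp: nonunits_def\<close>)
  have *: "m + n \<in> nonunits" if "m \<in> nonunits" "n \<in> nonunits" "m / n \<in> R" "n \<noteq> 0" for m n
    using mult[OF add_mem[OF one_mem that(3)] that(2)] that(4) by (simp add: distrib_right add.commute)
  show "m + n \<in> nonunits" if mn: "m \<in> nonunits" "n \<in> nonunits" for m n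
  proof (cases "m = 0 \<or> n = 0")
    case False
    then show ?thesis
      using valuation[of "m / n"] *[OF mn] *[OF mn(2,1)] by (auto simp: add.commute)
  qed (use mn in auto)
qed (auto simp: nonunits_def zero_mem one_mem)

text \<open>For \<open>a \<noteq> 0\<close>, \<open>x / a \<in> R\<close> would force
  \<open>x \<in> A\<close>; hence \<open>a / x\<close> lies in \<open>R\<close> and is a nonunit.
  The resulting inclusion of \<open>A\<close> in x M, for M the maximal ideal, is the main estimate
  on valuation domains.\<close>

lemma not_mem_frac:
  assumes A: "A \<in> fractional_ideals R" and x: "x \<notin> A" and a: "a \<in> A"
  shows "\<exists>m\<in>nonunits. a = x * m"
proof -
  have x0: "x \<noteq> 0" using frac_zero[OF A] x by auto
  show ?thesis
  proof (cases "a = 0")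
    case True
    then show ?thesis using frac_zero[OF nonunits_frac] by force
  next
    case False
    have "inverse (a / x) \<notin> R"
      using frac_mult[OF A _ a, of "x / a"] x False by auto
    then show ?thesis using valuation[of "a / x"] x0 False
      by (intro bexI[of _ "a / x"]) (auto simp: nonunits_def)
  qed
qed

lemma frac_linear:
  assumes A: "A \<in> fractional_ideals R" and B: "B \<in> fractional_ideals R"
  shows "A \<subseteq> B \<or> B \<subseteq> A"
proof (rule ccontr)
  assume "\<not> ?thesis"
  then obtain x y where xy: "x \<in> A" "x \<notin> B" "y \<in> B" "y \<notin> A" by blast
  obtain m where "m \<in> nonunits" "y = x * m" using not_mem_frac[OF B xy(2,3)] by blast
  then show False using frac_mult[OF A _ xy(1), of m] xy(4) by (auto simp: nonunits_def mult.commute)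
qed

text \<open>Fractional ideals are linearly ordered, so an intersection is just the smaller ideal and
  monotonicity suffices. Stability of glued operations comes from here.\<close>

lemma star_Int:
  assumes "s \<in> Star R" "A \<in> fractional_ideals R" "B \<in> fractional_ideals R"
  shows "s (A \<inter> B) = s A \<inter> s B"
  using frac_linear[OF assms(2,3)] star_mono[OF assms(1)] assms(2,3)
  by (metis Int_absorb1 Int_absorb2)

text \<open>\<open>a \<notin> A\<close> puts \<open>A\<close> inside a M, where M is
  \<open>nonunits\<close>; closing gives a \<in> a s(M), and \<open>a\<close> can be cancelled. So
  an operation that enlarges any ideal has 1 in the closure of M.\<close>

lemma one_mem_star_nonunits:
  assumes s: "s \<in> Star R" and A: "A \<in> fractional_ideals R" and a: "a \<in> s A" "a \<notin> A"
  shows "1 \<in> s nonunits"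
proof -
  have "A \<subseteq> (*) a ` nonunits" using not_mem_frac[OF A a(2)] by blast
  then have "s A \<subseteq> (*) a ` s nonunits"
    using star_mono[OF s A frac_scale[OF nonunits_frac]] star_scale[OF s nonunits_frac] by metis
  moreover have "a \<noteq> 0" using frac_zero[OF A] a(2) by auto
  ultimately show ?thesis using a(1) by auto
qed

text \<open>The last hypothesis says that a M \<subseteq> A; closing both sides turns 1 \<in> s(M)
  into a \<in> s(A).\<close>

lemma mem_starI:
  assumes s: "s \<in> Star R" and A: "A \<in> fractional_ideals R"
    and one: "1 \<in> s nonunits" and a: "\<And>m. m \<in> nonunits \<Longrightarrow> a * m \<in> A"
  shows "a \<in> s A"
proof -
  have "(*) a ` nonunits \<subseteq> A" using a by blast
  then have "(*) a ` s nonunits \<subseteq> s A"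
    using star_mono[OF s frac_scale[OF nonunits_frac] A] star_scale[OF s nonunits_frac] by metis
  then show ?thesis using one by force
qed

text \<open>Whatever \<open>s\<close> adds to \<open>A\<close> multiplies M into \<open>A\<close>,
  and if 1 \<in> t(M) then \<open>t\<close> adds all such elements.\<close>

lemma star_leI:
  assumes "s \<in> Star R" "t \<in> Star R" "1 \<in> s nonunits \<Longrightarrow> 1 \<in> t nonunits"
  shows "star_le R s t"
  unfolding star_le_def
proof (intro ballI subsetI)
  fix A a assume A: "A \<in> fractional_ideals R" and a: "a \<in> s A"
  show "a \<in> t A"
  proof (cases "a \<in> A")
    case True
    then show ?thesis using star_extensive[OF assms(2) A] by blast
  next
    case False
    then have "1 \<in> t nonunits" using one_mem_star_nonunits[OF assms(1) A a] assms(3) by blast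
    moreover have "a * m \<in> t A" if "m \<in> nonunits" for m
    proof -
      \<comment> \<open>If \<open>a * m\<close> were outside \<open>A\<close>, then A \<subseteq> a
        m M, and closing gives a = a m k with k \<in> s(M) \<subseteq> R; this would make
        \<open>m\<close> a unit.\<close>
      have "a * m \<in> A"
      proof (rule ccontr)
        assume n: "a * m \<notin> A"
        have "A \<subseteq> (*) (a * m) ` nonunits" using not_mem_frac[OF A n] by blast
        then have "s A \<subseteq> (*) (a * m) ` s nonunits"
          using star_mono[OF assms(1) A frac_scale[OF nonunits_frac]]
            star_scale[OF assms(1) nonunits_frac] by metis
        then obtain k where k: "k \<in> s nonunits" "a = a * m * k" using a by blast
        have "s nonunits \<subseteq> R"
          using star_mono[OF assms(1) nonunits_frac frac_self] star_self[OF assms(1)]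
          unfolding nonunits_def by blast
        moreover have "a \<noteq> 0" using n frac_zero[OF A] by auto
        ultimately have "inverse m \<in> R" "m \<noteq> 0"
          using k inverse_unique[of m k] by auto
        then show False using that unfolding nonunits_def by blast
      qed
      then show ?thesis using star_extensive[OF assms(2) A] by blast
    qed
    ultimately show ?thesis
      using mem_starI[OF assms(2) star_frac[OF assms(2) A]] star_idem[OF assms(2) A] by blast
  qed
qed

text \<open>For false \<open>b\<close> this is the identity, for true \<open>b\<close> it is the
  colon operation A \<mapsto> (A : M) with the maximal ideal M.\<close>

definition local_star :: "bool \<Rightarrow> 'a set \<Rightarrow> 'a set" where
  "local_star b = (\<lambda>A\<in>fractional_ideals R. {x. x \<in> A \<or> b \<and> (\<forall>m\<in>nonunits. x * m \<in> A)})"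

lemma local_star_mem:
  "A \<in> fractional_ideals R \<Longrightarrow>
    x \<in> local_star b A \<longleftrightarrow> x \<in> A \<or> b \<and> (\<forall>m\<in>nonunits. x * m \<in> A)"
  unfolding local_star_def by simp

text \<open>This closure is idempotent because a nonprincipal maximal ideal \<open>M\<close> of a valuation domain
  satisfies \<open>M = M\<^sup>2\<close>.\<close>

lemma local_star_Star:
  assumes np: "b \<Longrightarrow> \<forall>x. nonunits \<noteq> (*) x ` R"
  shows "local_star b \<in> Star R"
proof -
  note fM = nonunits_frac
  have nz: "\<exists>m\<in>nonunits. m \<noteq> 0" if b
  proof (rule ccontr)
    assume "\<not> ?thesis"
    then have "nonunits = (*) 0 ` R" using frac_zero[OF fM] one_mem by auto
    then show False using np[OF that] by blast
  qed
  \<comment> \<open>Since M is larger than m R, some n \<in> M is not a multiple of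
    \<open>m\<close>, and then \<open>m\<close> is \<open>n\<close> times a nonunit.\<close>
  have sq: "\<exists>m1\<in>nonunits. \<exists>m2\<in>nonunits. m = m1 * m2" if b: b and m: "m \<in> nonunits" for m
  proof -
    have "(*) m ` R \<subseteq> nonunits" using frac_mult[OF fM _ m] by (auto simp: mult.commute)
    then obtain n where n: "n \<in> nonunits" "n \<notin> (*) m ` R" using np[OF b] by blast
    have "m \<in> (*) m ` R" using one_mem by force
    then obtain k where "k \<in> nonunits" "m = n * k"
      using not_mem_frac[OF frac_scale[OF frac_self] n(2)] by blast
    then show ?thesis using n by blast
  qed
  have fr: "local_star b A \<in> fractional_ideals R" if A: "A \<in> fractional_ideals R" for A
  proof (cases b)
    case False
    then show ?thesis using A unfolding local_star_def by simp
  next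
    case True
    obtain m where m: "m \<in> nonunits" "m \<noteq> 0" using nz[OF True] by blast
    obtain d where d: "d \<in> R" "d \<noteq> 0" "\<And>x. x \<in> A \<Longrightarrow> d * x \<in> R"
      using frac_denom[OF A] by blast
    have mem: "x \<in> local_star b A \<longleftrightarrow> (\<forall>m\<in>nonunits. x * m \<in> A)" for x
      using local_star_mem[OF A] True frac_mult[OF A]
      by (auto simp: nonunits_def mult.commute)
    \<comment> \<open>\<open>m\<close> carries (A : M) into \<open>A\<close> and \<open>d\<close>
      carries \<open>A\<close> into \<open>R\<close>, so \<open>d * m\<close> is a
      denominator.\<close>
    show ?thesis
    proof (rule fractionalI[of _ "d * m"], unfold mem)
      show "\<forall>n\<in>nonunits. 0 * n \<in> A" using frac_zero[OF A] by simp
      show "\<forall>n\<in>nonunits. (x + y) * n \<in> A"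
        if "\<forall>n\<in>nonunits. x * n \<in> A" "\<forall>n\<in>nonunits. y * n \<in> A" for x y
        using that frac_add[OF A] by (auto simp: distrib_right)
      show "\<forall>n\<in>nonunits. r * x * n \<in> A" if "r \<in> R" "\<forall>n\<in>nonunits. x * n \<in> A" for r x
        using that frac_mult[OF A] by (auto simp: mult.assoc)
      show "d * m * x \<in> R" if "\<forall>n\<in>nonunits. x * n \<in> A" for x
        using d(3)[of "x * m"] that m(1) by (simp add: mult.assoc mult.commute[of x])
      show "d * m \<in> R" using d m mult_mem unfolding nonunits_def by blast
    qed (use d m in auto)
  qed
  have idem: "local_star b (local_star b A) = local_star b A" if A: "A \<in> fractional_ideals R" for A
  proof
    show "local_star b (local_star b A) \<subseteq> local_star b A"
    proof
      fix x assume x: "x \<in> local_star b (local_star b A)"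
      show "x \<in> local_star b A"
      proof (rule ccontr)
        assume nx: "x \<notin> local_star b A"
        have b: b and xm: "\<And>m. m \<in> nonunits \<Longrightarrow> x * m \<in> local_star b A"
          using x nx local_star_mem[OF fr[OF A]] by auto
        have "x * m \<in> A" if m: "m \<in> nonunits" for m
        proof -
          obtain p q where pq: "p \<in> nonunits" "q \<in> nonunits" "m = p * q" using sq[OF b m] by blast
          from xm[OF pq(1)] consider "x * p \<in> A" | "x * p * q \<in> A"
            using local_star_mem[OF A] pq(2) by blast
          then show ?thesis
            using frac_mult[OF A, of q "x * p"] pq by cases (auto simp: nonunits_def mult_ac)
        qed
        then show False using nx b local_star_mem[OF A] by blast
      qed
    qed
  qed (use local_star_mem[OF fr[OF A]] in blast)
  have self: "local_star b R = R"
  proof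
    show "local_star b R \<subseteq> R"
    proof
      fix x assume x: "x \<in> local_star b R"
      show "x \<in> R"
      proof (rule ccontr)
        assume nx: "x \<notin> R"
        then have b: b and xm: "\<And>m. m \<in> nonunits \<Longrightarrow> x * m \<in> R"
          using x local_star_mem[OF frac_self] by auto
        have x0: "x \<noteq> 0" using nx zero_mem by auto
        \<comment> \<open>With \<open>x\<close> outside \<open>R\<close>, x M \<subseteq> R would
          make M the principal ideal generated by \<open>inverse x\<close>.\<close>
        have "inverse x \<in> nonunits" using valuation[of x] nx unfolding nonunits_def by simp
        then have "(*) (inverse x) ` R \<subseteq> nonunits"
          using frac_mult[OF fM] by (auto simp: mult.commute)
        moreover have "m \<in> (*) (inverse x) ` R" if "m \<in> nonunits" for m
          using xm[OF that] x0 by (intro image_eqI[of _ _ "x * m"]) (auto simp: field_simps)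
        ultimately show False using np[OF b] by blast
      qed
    qed
  qed (use local_star_mem[OF frac_self] in blast)
  have scale: "local_star b ((*) x ` A) = (*) x ` local_star b A"
    if A: "A \<in> fractional_ideals R" for A x
  proof (cases "x = 0")
    case True
    have z: "(*) x ` B = {0}" if "B \<in> fractional_ideals R" for B
      using True frac_zero[OF that] by auto
    \<comment> \<open>Membership in a scaled set is tested by dividing by \<open>x\<close>, so the
      zero ideal is treated apart; when \<open>b\<close> holds, it is closed because M has a nonzero
      element.\<close>
    have "local_star b {0} = {0}"
      using local_star_mem[of "{0}"] frac_scale[OF A, of x] z[OF A] nz by auto
    then show ?thesis using z[OF A] z[OF fr[OF A]] by simp
  next
    case False
    show ?thesis
      unfolding set_eq_iff local_star_mem[OF frac_scale[OF A]] mem_scale_iff[OF False] local_star_mem[OF A] by simp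
  qed
  show ?thesis
    unfolding Star_def
  proof (intro CollectI conjI ballI impI allI)
    show "local_star b \<in> fractional_ideals R \<rightarrow>\<^sub>E fractional_ideals R"
      using fr by (auto simp: PiE_iff local_star_def)
    fix A assume A: "A \<in> fractional_ideals R"
    show "A \<subseteq> local_star b A" using local_star_mem[OF A] by blast
    show "local_star b (local_star b A) = local_star b A" by (rule idem[OF A])
    show "local_star b A \<subseteq> local_star b B" if B: "B \<in> fractional_ideals R" "A \<subseteq> B" for B
      using local_star_mem[OF A] local_star_mem[OF B(1)] B(2) by blast
    show "local_star b ((*) x ` A) = (*) x ` local_star b A" for x by (rule scale[OF A])
  qed (rule self)
qed

end

section \<open>Localization at maximal ideals\<close>

context frac_domain
begin

text \<open>\<open>loc P I\<close> is the extension \<open>I R\<^sub>P\<close>.\<close>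

definition loc :: "'a set \<Rightarrow> 'a set \<Rightarrow> 'a set" where
  "loc P I = {x. \<exists>s\<in>R. s \<notin> P \<and> s * x \<in> I}"

lemma locI: "s \<in> R \<Longrightarrow> s \<notin> P \<Longrightarrow> s * x \<in> I \<Longrightarrow> x \<in> loc P I"
  unfolding loc_def by blast

lemma loc_mono: "I \<subseteq> J \<Longrightarrow> loc P I \<subseteq> loc P J"
  unfolding loc_def by blast

text \<open>The ideal (I :_R x); it contains 1 exactly when x \<in> I.\<close>

definition colon :: "'a set \<Rightarrow> 'a \<Rightarrow> 'a set" where
  "colon I x = {r \<in> R. r * x \<in> I}"

lemma colon_frac: "I \<in> fractional_ideals R \<Longrightarrow> colon I x \<in> fractional_ideals R"
  by (rule fractionalI[of _ 1])
    (auto simp: colon_def zero_mem one_mem frac_zero add_mem mult_mem frac_add distrib_right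
       frac_mult mult.assoc)

text \<open>If 1 \<notin> (I :_R x), some maximal ideal \<open>P\<close> contains this colon ideal,
  leaving no denominator outside \<open>P\<close> to put \<open>x\<close> into
  \<open>loc P I\<close>.\<close>

lemma local_global:
  assumes I: "I \<in> fractional_ideals R" and x: "\<And>P. P \<in> max_ideals R \<Longrightarrow> x \<in> loc P I"
  shows "x \<in> I"
proof -
  have "1 \<in> colon I x"
  proof (rule ccontr)
    assume "1 \<notin> colon I x"
    then obtain P where "P \<in> max_ideals R" "colon I x \<subseteq> P"
      using exists_max_ideal[OF colon_frac[OF I]] unfolding colon_def by blast
    then show False using x[of P] unfolding loc_def colon_def by blast
  qed
  then show ?thesis unfolding colon_def by simp
qed

context
  fixes P assumes P: "P \<in> max_ideals R"
begin

lemma not_mem_nonzero: "s \<notin> P \<Longrightarrow> s \<noteq> 0"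
  using frac_zero[OF max_frac[OF P]] by blast

lemma localization_eq: "localization R P = loc P R"
proof -
  have "x \<in> loc P R" if x: "x \<in> localization R P" for x
  proof -
    obtain a s where a: "x = a / s" "a \<in> R" "s \<in> R" "s \<notin> P"
      using x unfolding localization_def by blast
    then show ?thesis using not_mem_nonzero[of s] by (intro locI[of s]) auto
  qed
  moreover have "x \<in> localization R P" if x: "x \<in> loc P R" for x
  proof -
    obtain s where s: "s \<in> R" "s \<notin> P" "s * x \<in> R" using x unfolding loc_def by blast
    then have "x = (s * x) / s" using not_mem_nonzero by simp
    then show ?thesis using s unfolding localization_def by blast
  qed
  ultimately show ?thesis by blast
qed

lemma loc_extensive: "I \<subseteq> loc P I"
  using one_mem max_one[OF P] unfolding loc_def by force

lemma loc_add:
  assumes I: "I \<in> fractional_ideals R" and x: "x \<in> loc P I" "y \<in> loc P I"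
  shows "x + y \<in> loc P I"
proof -
  obtain s t where s: "s \<in> R" "s \<notin> P" "s * x \<in> I" and t: "t \<in> R" "t \<notin> P" "t * y \<in> I"
    using x unfolding loc_def by blast
  have "s * t * (x + y) = t * (s * x) + s * (t * y)" by (simp add: algebra_simps)
  then have "s * t * (x + y) \<in> I"
    using frac_add[OF I] frac_mult[OF I t(1) s(3)] frac_mult[OF I s(1) t(3)] by auto
  then show ?thesis using locI[of "s * t"] mult_mem max_prime[OF P] s t by blast
qed

lemma loc_mult:
  assumes I: "I \<in> fractional_ideals R" and x: "x \<in> loc P R" "y \<in> loc P I"
  shows "x * y \<in> loc P I"
proof -
  obtain s t where s: "s \<in> R" "s \<notin> P" "s * x \<in> R" and t: "t \<in> R" "t \<notin> P" "t * y \<in> I"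
    using x unfolding loc_def by blast
  have "(s * t) * (x * y) = (s * x) * (t * y)" by (simp add: algebra_simps)
  then have "(s * t) * (x * y) \<in> I" using frac_mult[OF I s(3) t(3)] by (rule ssubst)
  then show ?thesis using locI[of "s * t"] mult_mem max_prime[OF P] s t by blast
qed

lemma loc_frac_domain: "frac_domain (loc P R)"
proof
  show "\<exists>a\<in>loc P R. \<exists>b\<in>loc P R. b \<noteq> 0 \<and> x = a / b" for x
    using quotient[of x] loc_extensive[of R] by blast
  show "- x \<in> loc P R" if "x \<in> loc P R" for x
    using loc_mult[OF frac_self _ that, of "- 1"] uminus_mem[OF one_mem] loc_extensive[of R] by auto
  show "0 \<in> loc P R" "1 \<in> loc P R" using loc_extensive[of R] zero_mem one_mem by blast+
qed (fact loc_add[OF frac_self] loc_mult[OF frac_self])+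

lemma loc_frac:
  assumes I: "I \<in> fractional_ideals R"
  shows "loc P I \<in> fractional_ideals (loc P R)"
proof -
  interpret L: frac_domain "loc P R" by (rule loc_frac_domain)
  obtain d where d: "d \<in> R" "d \<noteq> 0" "\<And>x. x \<in> I \<Longrightarrow> d * x \<in> R" using frac_denom[OF I] by blast
  show ?thesis
  proof (rule L.fractionalI[of _ d])
    show "0 \<in> loc P I" using loc_extensive frac_zero[OF I] by blast
    show "d \<in> loc P R" using loc_extensive d by blast
    show "d * x \<in> loc P R" if x: "x \<in> loc P I" for x
    proof -
      obtain s where s: "s \<in> R" "s \<notin> P" "s * x \<in> I" using x unfolding loc_def by blast
      then have "s * (d * x) \<in> R" using d(3)[OF s(3)] by (simp add: mult.left_commute)
      then show ?thesis by (rule locI[OF s(1,2)])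
    qed
  qed (fact d(2) loc_add[OF I] loc_mult[OF I])+
qed

lemma loc_Int:
  assumes I: "I \<in> fractional_ideals R" and J: "J \<in> fractional_ideals R"
  shows "loc P (I \<inter> J) = loc P I \<inter> loc P J"
proof
  show "loc P I \<inter> loc P J \<subseteq> loc P (I \<inter> J)"
  proof
    fix x assume "x \<in> loc P I \<inter> loc P J"
    then obtain s t where s: "s \<in> R" "s \<notin> P" "s * x \<in> I" and t: "t \<in> R" "t \<notin> P" "t * x \<in> J"
      unfolding loc_def by blast
    have "(s * t) * x \<in> I \<inter> J"
      using frac_mult[OF I t(1) s(3)] frac_mult[OF J s(1) t(3)] by (simp add: mult_ac)
    then show "x \<in> loc P (I \<inter> J)" using locI[of "s * t"] mult_mem max_prime[OF P] s t by blast
  qed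
qed (auto simp: loc_def)

lemma loc_scale:
  assumes I: "I \<in> fractional_ideals R"
  shows "loc P ((*) x ` I) = (*) x ` loc P I"
proof (cases "x = 0")
  case True
  have "(*) x ` I = {0}" "(*) x ` loc P I = {0}"
    using True frac_zero[OF I] loc_extensive[of I] by auto
  moreover have "loc P {0} \<subseteq> {0}" using not_mem_nonzero unfolding loc_def by auto
  then have "loc P {0} = {0}" using loc_extensive[of "{0}"] by blast
  ultimately show ?thesis by simp
next
  case False
  then show ?thesis unfolding set_eq_iff loc_def mem_Collect_eq mem_scale_iff[OF False] by simp
qed

text \<open>Identifies \<open>loc P I\<close> with the product used in the theorem. A single product
  already represents each element: x = (s x)(1/s) for a denominator \<open>s\<close>.\<close>

lemma ideal_prod_localization:
  assumes I: "I \<in> fractional_ideals R"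
  shows "ideal_prod quot_field I (localization R P) = loc P I"
proof
  show "ideal_prod quot_field I (localization R P) \<subseteq> loc P I"
  proof
    fix x :: 'a assume "x \<in> ideal_prod quot_field I (localization R P)"
    then show "x \<in> loc P I"
    proof (induction rule: ideal_prod.induct)
      case (prod i j)
      then show ?case
        using loc_mult[OF I, of j i] loc_extensive[of I] unfolding localization_eq
        by (auto simp: ring_of_type_algebra_def mult.commute)
    next
      case (sum s1 s2)
      then show ?case using loc_add[OF I] by (simp add: ring_of_type_algebra_def)
    qed
  qed
  show "loc P I \<subseteq> ideal_prod quot_field I (localization R P)"
  proof
    fix x assume "x \<in> loc P I"
    then obtain s where s: "s \<in> R" "s \<notin> P" "s * x \<in> I" unfolding loc_def by blast
    have "1 / s \<in> localization R P" using s one_mem unfolding localization_def by blast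
    then have "(s * x) \<otimes>\<^bsub>quot_field\<^esub> (1 / s) \<in> ideal_prod quot_field I (localization R P)"
      by (rule ideal_prod.prod[OF s(3)])
    then show "x \<in> ideal_prod quot_field I (localization R P)"
      using not_mem_nonzero[OF s(2)] by (simp add: ring_of_type_algebra_def)
  qed
qed

text \<open>If \<open>s * m \<in> R\<close> with \<open>s \<notin> P\<close> and
  \<open>m \<notin> loc P P\<close>, then \<open>s * m\<close> lies outside \<open>P\<close> and is
  a denominator for \<open>inverse m\<close>.\<close>

lemma loc_nonunits: "frac_domain.nonunits (loc P R) = loc P P"
proof -
  interpret L: frac_domain "loc P R" by (rule loc_frac_domain)
  have "m \<in> loc P P \<longleftrightarrow> m = 0 \<or> inverse m \<notin> loc P R" if m: "m \<in> loc P R" for m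
  proof (cases "m = 0")
    case True
    then show ?thesis using loc_extensive[of P] frac_zero[OF max_frac[OF P]] by auto
  next
    case False
    have "\<not> inverse m \<in> loc P R" if mP: "m \<in> loc P P"
    proof
      assume "inverse m \<in> loc P R"
      then have "inverse m * m \<in> loc P P" using loc_mult[OF max_frac[OF P] _ mP] by blast
      then obtain s where s: "s \<in> R" "s \<notin> P" "s * 1 \<in> P" using False unfolding loc_def by auto
      then show False by simp
    qed
    moreover have "inverse m \<in> loc P R" if nm: "m \<notin> loc P P"
    proof -
      obtain s where s: "s \<in> R" "s \<notin> P" "s * m \<in> R" using m unfolding loc_def by blast
      have "s * m \<notin> P" using s nm unfolding loc_def by blast
      moreover have "(s * m) * inverse m \<in> R" using s(1) False by (simp add: mult.assoc)
      ultimately show ?thesis using s(3) unfolding loc_def by blast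
    qed
    ultimately show ?thesis using False by blast
  qed
  moreover have "loc P P \<subseteq> loc P R" by (rule loc_mono[OF max_subset[OF P]])
  ultimately show ?thesis unfolding L.nonunits_def by blast
qed

end

end

section \<open>Invertibility of two-generated ideals\<close>

text \<open>Only the invertibility of two-generated ideals is needed: \<open>u\<close> and \<open>v\<close> lie in the inverse of \<open>(a, b)\<close>.\<close>

locale prufer = frac_domain +
  assumes two_generated: "a \<in> R \<Longrightarrow> b \<in> R \<Longrightarrow> a \<noteq> 0 \<Longrightarrow>
    \<exists>u v. a * u + b * v = 1 \<and> a * u \<in> R \<and> a * v \<in> R \<and> b * u \<in> R \<and> b * v \<in> R"

text \<open>Invertibility writes 1 as a sum of products from (a, b) and its inverse; collecting the
  terms with \<open>a\<close> and those with \<open>b\<close> gives \<open>u\<close> and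
  \<open>v\<close>.\<close>

lemma pruferI:
  assumes "prufer_domain (R::'a::field set)"
  shows "prufer R"
proof -
  interpret frac_domain R using assms frac_domainI unfolding prufer_domain_def by blast
  interpret cring "ring_on R" by (rule cring_ring_on)
  show ?thesis
  proof
    fix a b assume ab: "a \<in> R" "b \<in> R" "a \<noteq> 0"
    define I where "I = Idl\<^bsub>ring_on R\<^esub> {a, b}"
    have "ideal I (ring_on R)" unfolding I_def by (rule genideal_ideal) (use ab in auto)
    then have I: "I \<in> fractional_ideals R" "I \<subseteq> R" unfolding ideal_iff by auto
    have abI: "a \<in> I" "b \<in> I" using genideal_self[of "{a,b}"] ab unfolding I_def by auto
    \<comment> \<open>The explicit ideal a R + b R; that it contains \<open>I\<close> gives every
      element of \<open>I\<close> the form a r + b s.\<close>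
    define G where "G = {a * r + b * s | r s. r \<in> R \<and> s \<in> R}"
    have "G \<in> fractional_ideals R"
    proof (rule fractionalI[of _ 1])
      show "0 \<in> G" unfolding G_def using zero_mem by force
      show "x + y \<in> G" if xy: "x \<in> G" "y \<in> G" for x y
      proof -
        obtain r s r' s' where "x = a * r + b * s" "y = a * r' + b * s'"
          "r \<in> R" "s \<in> R" "r' \<in> R" "s' \<in> R" using xy unfolding G_def by blast
        then have "x + y = a * (r + r') + b * (s + s')" "r + r' \<in> R" "s + s' \<in> R"
          using add_mem by (auto simp: algebra_simps)
        then show ?thesis unfolding G_def by blast
      qed
      show "t * x \<in> G" if x: "t \<in> R" "x \<in> G" for t x
      proof -
        obtain r s where "x = a * r + b * s" "r \<in> R" "s \<in> R" using x unfolding G_def by blast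
        then have "t * x = a * (t * r) + b * (t * s)" "t * r \<in> R" "t * s \<in> R"
          using mult_mem x by (auto simp: algebra_simps)
        then show ?thesis unfolding G_def by blast
      qed
      show "1 * x \<in> R" if "x \<in> G" for x
        using that ab add_mem mult_mem unfolding G_def by auto
    qed (auto simp: one_mem)
    moreover have "G \<subseteq> R" using ab add_mem mult_mem unfolding G_def by auto
    ultimately have G: "ideal G (ring_on R)" unfolding ideal_iff by blast
    have "a * 1 + b * 0 \<in> G" "a * 0 + b * 1 \<in> G"
      unfolding G_def using zero_mem one_mem by blast+
    then have IG: "I \<subseteq> G" unfolding I_def using genideal_minimal[OF G, of "{a,b}"] by auto
    have "I \<noteq> {0}" using abI ab by auto
    moreover have "finite {a, b}" "{a, b} \<subseteq> R" using ab by auto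
    ultimately have "invertible_ideal R I"
      using assms unfolding prufer_domain_def I_def by blast
    then obtain J where J: "J \<in> fractional_ideals R" "ideal_prod quot_field I J = R"
      unfolding invertible_ideal_def by blast
    have "\<exists>u\<in>J. \<exists>v\<in>J. z = a * u + b * v" if "z \<in> ideal_prod quot_field I J" for z
      using that
    proof (induction rule: ideal_prod.induct)
      case (prod i j)
      then obtain r s where rs: "i = a * r + b * s" "r \<in> R" "s \<in> R" using IG unfolding G_def by blast
      have "i \<otimes>\<^bsub>quot_field\<^esub> j = a * (r * j) + b * (s * j)"
        using rs by (simp add: ring_of_type_algebra_def algebra_simps)
      then show ?case using frac_mult[OF J(1)] rs prod by blast
    next
      case (sum z w)
      then obtain u v u' v' where uv: "z = a * u + b * v" "w = a * u' + b * v'"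
        "u \<in> J" "v \<in> J" "u' \<in> J" "v' \<in> J" by blast
      then have "z \<oplus>\<^bsub>quot_field\<^esub> w = a * (u + u') + b * (v + v')"
        by (simp add: ring_of_type_algebra_def algebra_simps)
      then show ?case using frac_add[OF J(1)] uv by blast
    qed
    then obtain u v where uv: "u \<in> J" "v \<in> J" "1 = a * u + b * v" using J one_mem by blast
    have "i * j \<in> R" if "i \<in> I" "j \<in> J" for i j
      using ideal_prod.prod[OF that, of quot_field] J by (simp add: ring_of_type_algebra_def)
    then show "\<exists>u v. a * u + b * v = 1 \<and> a * u \<in> R \<and> a * v \<in> R \<and> b * u \<in> R \<and> b * v \<in> R"
      using uv abI by metis
  qed
qed

context prufer
begin

text \<open>For x = a/b, one of \<open>b * u\<close> and \<open>a * v\<close> lies outside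
  \<open>P\<close> because they sum to 1. As b u x = a u and a v / x = b v, it is a denominator for
  \<open>x\<close> or for \<open>inverse x\<close> respectively.\<close>

lemma loc_valuation:
  assumes P: "P \<in> max_ideals R"
  shows "valuation_domain (loc P R)"
proof (rule valuation_domain.intro[OF loc_frac_domain[OF P]], unfold_locales)
  fix x
  obtain a b where ab: "a \<in> R" "b \<in> R" "b \<noteq> 0" "x = a / b" using quotient by blast
  obtain u v where uv: "b * u + a * v = 1" "b * u \<in> R" "b * v \<in> R" "a * u \<in> R" "a * v \<in> R"
    using two_generated[OF ab(2,1,3)] by blast
  show "x \<in> loc P R \<or> inverse x \<in> loc P R"
  proof (cases "b * u \<in> P")
    case False
    then have "x \<in> loc P R"
      using uv ab by (intro locI[of "b * u"]) (auto simp: mult_ac)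
    then show ?thesis ..
  next
    case True
    then have av: "a * v \<notin> P"
      using frac_add[OF max_frac[OF P] True] uv(1) max_one[OF P] by metis
    then have "a \<noteq> 0" using frac_zero[OF max_frac[OF P]] by auto
    then have "inverse x \<in> loc P R"
      using uv ab av by (intro locI[of "a * v"]) (auto simp: mult_ac)
    then show ?thesis ..
  qed
qed

end

section \<open>Gluing star operations\<close>

context frac_domain
begin

definition glue :: "('a set \<Rightarrow> 'a set \<Rightarrow> 'a set) \<Rightarrow> 'a set \<Rightarrow> 'a set" where
  "glue s = (\<lambda>I\<in>fractional_ideals R. \<Inter>P\<in>max_ideals R. s P (loc P I))"

lemma glue_mem:
  "I \<in> fractional_ideals R \<Longrightarrow> x \<in> glue s I \<longleftrightarrow> (\<forall>P\<in>max_ideals R. x \<in> s P (loc P I))"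
  unfolding glue_def by simp

text \<open>Every denominator outside \<open>P\<close> is invertible in \<open>loc P R\<close> and
  can be cancelled inside \<open>A\<close>.\<close>

lemma loc_subset:
  assumes P: "P \<in> max_ideals R" and A: "A \<in> fractional_ideals (loc P R)" and "I \<subseteq> A"
  shows "loc P I \<subseteq> A"
proof
  fix x assume "x \<in> loc P I"
  then obtain s where s: "s \<in> R" "s \<notin> P" "s * x \<in> A" using assms(3) unfolding loc_def by blast
  have s0: "s \<noteq> 0" using not_mem_nonzero[OF P] s by blast
  have "inverse s \<in> loc P R" using s s0 one_mem by (intro locI[of s]) auto
  then have "inverse s * (s * x) \<in> A"
    by (rule frac_domain.frac_mult[OF loc_frac_domain[OF P] A _ s(3)])
  then show "x \<in> A" using s0 by (simp flip: mult.assoc)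
qed

lemma one_mem_loc:
  assumes "\<not> I \<subseteq> Q" "I \<subseteq> R"
  shows "1 \<in> loc Q I"
proof -
  obtain p where "p \<in> I" "p \<notin> Q" using assms by blast
  then show ?thesis using assms by (intro locI[of p]) auto
qed

context
  fixes s assumes s: "\<And>P. P \<in> max_ideals R \<Longrightarrow> s P \<in> Star (loc P R)"
begin

lemma local_star_frac:
  assumes "P \<in> max_ideals R" "I \<in> fractional_ideals R"
  shows "s P (loc P I) \<in> fractional_ideals (loc P R)"
  using assms frac_domain.star_frac[OF loc_frac_domain s loc_frac] by blast

lemma local_star_mono:
  assumes "P \<in> max_ideals R" "I \<in> fractional_ideals R" "J \<in> fractional_ideals R" "I \<subseteq> J"
  shows "s P (loc P I) \<subseteq> s P (loc P J)"
  using assms frac_domain.star_mono[OF loc_frac_domain s loc_frac loc_frac loc_mono] by blast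

lemma local_star_scale:
  assumes P: "P \<in> max_ideals R" and I: "I \<in> fractional_ideals R"
  shows "s P (loc P ((*) x ` I)) = (*) x ` s P (loc P I)"
  using frac_domain.star_scale[OF loc_frac_domain[OF P] s[OF P] loc_frac[OF P I]] loc_scale[OF P I]
  by simp

lemma local_star_self: "P \<in> max_ideals R \<Longrightarrow> s P (loc P R) = loc P R"
  using frac_domain.star_self[OF loc_frac_domain s] by blast

lemma local_star_extensive:
  assumes "P \<in> max_ideals R" "I \<in> fractional_ideals R"
  shows "loc P I \<subseteq> s P (loc P I)"
  using assms frac_domain.star_extensive[OF loc_frac_domain s loc_frac] by blast

text \<open>A denominator \<open>d\<close> for \<open>I\<close> also serves for the glued closure:
  close d I \<subseteq> R at every \<open>P\<close>, then use \<open>local_global\<close>.\<close>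

lemma glue_frac:
  assumes I: "I \<in> fractional_ideals R"
  shows "glue s I \<in> fractional_ideals R"
proof -
  obtain d where d: "d \<in> R" "d \<noteq> 0" "\<And>x. x \<in> I \<Longrightarrow> d * x \<in> R" using frac_denom[OF I] by blast
  note mem = glue_mem[OF I, of _ s]
  show ?thesis
  proof (rule fractionalI[of _ d], unfold mem)
    show "\<forall>P\<in>max_ideals R. 0 \<in> s P (loc P I)"
      using frac_domain.frac_zero[OF loc_frac_domain local_star_frac[OF _ I]] by blast
    show "\<forall>P\<in>max_ideals R. x + y \<in> s P (loc P I)"
      if "\<forall>P\<in>max_ideals R. x \<in> s P (loc P I)" "\<forall>P\<in>max_ideals R. y \<in> s P (loc P I)" for x y
      using that frac_domain.frac_add[OF loc_frac_domain local_star_frac[OF _ I]] by blast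
    show "\<forall>P\<in>max_ideals R. r * x \<in> s P (loc P I)"
      if "r \<in> R" "\<forall>P\<in>max_ideals R. x \<in> s P (loc P I)" for r x
      using that frac_domain.frac_mult[OF loc_frac_domain local_star_frac[OF _ I]]
        loc_extensive[of _ R] by blast
    show "d * x \<in> R" if x: "\<forall>P\<in>max_ideals R. x \<in> s P (loc P I)" for x
    proof (rule local_global[OF frac_self])
      fix P assume P: "P \<in> max_ideals R"
      have "(*) d ` I \<subseteq> R" using d by blast
      then have "(*) d ` s P (loc P I) \<subseteq> loc P R"
        using local_star_mono[OF P frac_scale[OF I] frac_self] local_star_self[OF P]
          local_star_scale[OF P I] by metis
      then show "d * x \<in> loc P R" using x P by blast
    qed
  qed (fact d)+
qed

text \<open>The glued closure lies in \<open>s P (loc P I)\<close>, which is closed under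
  \<open>s P\<close>, so a second application at \<open>P\<close> adds nothing.\<close>

lemma glue_idem:
  assumes I: "I \<in> fractional_ideals R"
  shows "glue s (glue s I) \<subseteq> glue s I"
proof
  fix x assume x: "x \<in> glue s (glue s I)"
  show "x \<in> glue s I"
    unfolding glue_mem[OF I]
  proof
    fix P assume P: "P \<in> max_ideals R"
    interpret L: frac_domain "loc P R" by (rule loc_frac_domain[OF P])
    have "glue s I \<subseteq> s P (loc P I)" using glue_mem[OF I] P by blast
    then have "loc P (glue s I) \<subseteq> s P (loc P I)" by (rule loc_subset[OF P local_star_frac[OF P I]])
    then have "s P (loc P (glue s I)) \<subseteq> s P (loc P I)"
      using L.star_mono[OF s[OF P] loc_frac[OF P glue_frac[OF I]] local_star_frac[OF P I]]
        L.star_idem[OF s[OF P] loc_frac[OF P I]] by metis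
    then show "x \<in> s P (loc P I)" using x P glue_mem[OF glue_frac[OF I]] by blast
  qed
qed

lemma glue_extensive:
  assumes I: "I \<in> fractional_ideals R"
  shows "I \<subseteq> glue s I"
  using glue_mem[OF I] local_star_extensive[OF _ I] loc_extensive by blast

lemma glue_Star: "glue s \<in> Star R"
  unfolding Star_def
proof (intro CollectI conjI ballI impI allI)
  show "glue s \<in> fractional_ideals R \<rightarrow>\<^sub>E fractional_ideals R"
    using glue_frac by (auto simp: PiE_iff glue_def)
  show "glue s R = R"
    using glue_mem[OF frac_self, of _ s] local_star_self local_global[OF frac_self]
      glue_extensive[OF frac_self] by blast
  fix I assume I: "I \<in> fractional_ideals R"
  show "I \<subseteq> glue s I" by (rule glue_extensive[OF I])
  show "glue s (glue s I) = glue s I"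
    using glue_idem[OF I] glue_extensive[OF glue_frac[OF I]] by blast
  show "glue s I \<subseteq> glue s J" if J: "J \<in> fractional_ideals R" "I \<subseteq> J" for J
    using glue_mem[OF I] glue_mem[OF J(1)] local_star_mono[OF _ I J] by blast
  show "glue s ((*) x ` I) = (*) x ` glue s I" for x
  proof (cases "x = 0")
    case True
    have z: "(*) x ` B = {0}" if "0 \<in> B" for B using True that by auto
    \<comment> \<open>A maximal ideal must exist here: an empty intersection would be the whole
      field instead of {0}.\<close>
    have "\<exists>P. P \<in> max_ideals R"
      using exists_max_ideal[of "(*) 0 ` R"] frac_scale[OF frac_self, of 0] z[OF zero_mem] True zero_mem
      by auto
    moreover have "0 \<in> s P (loc P I)" if "P \<in> max_ideals R" for P
      using frac_domain.frac_zero[OF loc_frac_domain local_star_frac[OF _ I]] that by blast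
    then have "s P (loc P ((*) x ` I)) = {0}" if "P \<in> max_ideals R" for P
      using that local_star_scale[OF that I] z by simp
    ultimately have "glue s ((*) x ` I) = {0}"
      using glue_mem[OF frac_scale[OF I], of _ s x] by blast
    then show ?thesis using z frac_zero[OF glue_frac[OF I]] by simp
  next
    case False
    then show ?thesis
      unfolding set_eq_iff glue_mem[OF frac_scale[OF I]] mem_scale_iff[OF False] glue_mem[OF I]
      using local_star_scale[OF _ I] mem_scale_iff[OF False] by simp
  qed
qed

end

end

context prufer
begin

text \<open>Both \<open>loc P\<close> and, in a valuation domain, every star operation preserve
  finite intersections.\<close>

lemma glue_stable:
  assumes s: "\<And>P. P \<in> max_ideals R \<Longrightarrow> s P \<in> Star (loc P R)"
  shows "glue s \<in> Star_st R"
proof -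
  have "glue s (I \<inter> J) = glue s I \<inter> glue s J"
    if I: "I \<in> fractional_ideals R" and J: "J \<in> fractional_ideals R" for I J
    unfolding set_eq_iff Int_iff glue_mem[OF I] glue_mem[OF J] glue_mem[OF frac_Int[OF I J]]
    using valuation_domain.star_Int[OF loc_valuation s loc_frac[OF _ I] loc_frac[OF _ J]]
      loc_Int[OF _ I J] by auto
  then show ?thesis
    using glue_Star[OF s] unfolding Star_st_def stable_def ideal_iff by blast
qed

text \<open>For Q \<noteq> P the extension \<open>loc Q P\<close> already contains 1, so only the
  component at \<open>P\<close> imposes a condition.\<close>

lemma one_mem_glue_max:
  assumes s: "\<And>P. P \<in> max_ideals R \<Longrightarrow> s P \<in> Star (loc P R)" and P: "P \<in> max_ideals R"
  shows "1 \<in> glue s P \<longleftrightarrow> 1 \<in> s P (loc P P)"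
proof -
  have "1 \<in> s Q (loc Q P)" if "Q \<in> max_ideals R" "Q \<noteq> P" for Q
    using one_mem_loc[OF max_not_subset max_subset] P that
      local_star_extensive[OF s that(1) max_frac[OF P]] by blast
  then show ?thesis unfolding glue_mem[OF max_frac[OF P]] using P by metis
qed

text \<open>Evaluating at \<open>P\<close> reads off whether \<open>1 \<in> s P (loc P P)\<close>,
  and by \<open>star_leI\<close> this bit decides the order between star operations of the valuation
  domain \<open>loc P R\<close>.\<close>

lemma glue_le_iff:
  assumes s: "\<And>P. P \<in> max_ideals R \<Longrightarrow> s P \<in> Star (loc P R)"
    and t: "\<And>P. P \<in> max_ideals R \<Longrightarrow> t P \<in> Star (loc P R)"
  shows "star_le R (glue s) (glue t) \<longleftrightarrow> (\<forall>P\<in>max_ideals R. star_le (loc P R) (s P) (t P))"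
proof
  assume le: "star_le R (glue s) (glue t)"
  show "\<forall>P\<in>max_ideals R. star_le (loc P R) (s P) (t P)"
  proof
    fix P assume P: "P \<in> max_ideals R"
    have "1 \<in> t P (loc P P)" if "1 \<in> s P (loc P P)"
      using le that one_mem_glue_max[OF s P] one_mem_glue_max[OF t P] max_frac[OF P]
      unfolding star_le_def by blast
    then show "star_le (loc P R) (s P) (t P)"
      by (intro valuation_domain.star_leI[OF loc_valuation[OF P] s[OF P] t[OF P]])
        (simp only: loc_nonunits[OF P])
  qed
next
  assume "\<forall>P\<in>max_ideals R. star_le (loc P R) (s P) (t P)"
  then show "star_le R (glue s) (glue t)"
    unfolding star_le_def using glue_mem loc_frac by blast
qed

end

section \<open>Stable star operations in the locally finite case\<close>

context frac_domain
begin

section \<open>Consequences of stability\<close>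

lemma star_zero:
  assumes "st \<in> Star R"
  shows "st {0} = {0}" "{0} \<in> fractional_ideals R"
proof -
  have "(*) 0 ` R = {0}" using zero_mem by auto
  then show "st {0} = {0}" "{0} \<in> fractional_ideals R"
    using star_scale[OF assms frac_self, of 0] star_self[OF assms] frac_scale[OF frac_self, of 0]
    by simp_all
qed

text \<open>Stability concerns ideals inside \<open>R\<close> only; the common denominator
  \<open>c = d * e\<close> scales both \<open>I\<close> and \<open>J\<close> into \<open>R\<close>,
  and scaling by it is injective.\<close>

lemma stable_Int:
  assumes st: "st \<in> Star_st R"
    and I: "I \<in> fractional_ideals R" and J: "J \<in> fractional_ideals R"
  shows "st (I \<inter> J) = st I \<inter> st J"
proof -
  have S: "st \<in> Star R" using st unfolding Star_st_def by blast
  obtain d where d: "d \<in> R" "d \<noteq> 0" "\<And>x. x \<in> I \<Longrightarrow> d * x \<in> R" using frac_denom[OF I] by blast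
  obtain e where e: "e \<in> R" "e \<noteq> 0" "\<And>x. x \<in> J \<Longrightarrow> e * x \<in> R" using frac_denom[OF J] by blast
  define c where "c = d * e"
  have c0: "c \<noteq> 0" unfolding c_def using d(2) e(2) by simp
  have inj: "inj ((*) c)" using c0 by (simp add: inj_def)
  have "c * x \<in> R" if "x \<in> I" for x
    using mult_mem[OF e(1) d(3)[OF that]] unfolding c_def by (simp add: mult_ac)
  moreover have "c * x \<in> R" if "x \<in> J" for x
    using mult_mem[OF d(1) e(3)[OF that]] unfolding c_def by (simp add: mult_ac)
  ultimately have "(*) c ` I \<subseteq> R" "(*) c ` J \<subseteq> R" by blast+
  then have id: "ideal ((*) c ` I) (ring_on R)" "ideal ((*) c ` J) (ring_on R)"
    unfolding ideal_iff using frac_scale[OF I] frac_scale[OF J] by blast+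
  have "\<And>A B. ideal A (ring_on R) \<Longrightarrow> ideal B (ring_on R) \<Longrightarrow> st (A \<inter> B) = st A \<inter> st B"
    using st unfolding Star_st_def stable_def by blast
  from this[OF id] have "st ((*) c ` I \<inter> (*) c ` J) = st ((*) c ` I) \<inter> st ((*) c ` J)" .
  then have "(*) c ` st (I \<inter> J) = (*) c ` (st I \<inter> st J)"
    unfolding image_Int[OF inj] star_scale[OF S I, symmetric] star_scale[OF S J, symmetric]
      star_scale[OF S frac_Int[OF I J], symmetric] .
  then show ?thesis unfolding inj_image_eq_iff[OF inj] .
qed

text \<open>For x \<noteq> 0, \<open>colon I x\<close> is the intersection of \<open>R\<close> with
  \<open>I\<close> scaled by \<open>inverse x\<close>, and stability lets the closure pass through
  this intersection.\<close>

lemma stable_mem_iff: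
  assumes st: "st \<in> Star_st R" and I: "I \<in> fractional_ideals R"
  shows "x \<in> st I \<longleftrightarrow> 1 \<in> st (colon I x)"
proof -
  have S: "st \<in> Star R" using st unfolding Star_st_def by blast
  show ?thesis
  proof (cases "x = 0")
    case True
    then have "colon I x = R" unfolding colon_def using frac_zero[OF I] by auto
    then show ?thesis using star_self[OF S] one_mem frac_zero[OF star_frac[OF S I]] True by simp
  next
    case False
    have "colon I x = R \<inter> (*) (inverse x) ` I"
      unfolding colon_def using mem_scale_iff[of "inverse x"] False by (auto simp: divide_inverse)
    then have "st (colon I x) = R \<inter> (*) (inverse x) ` st I"
      using stable_Int[OF st frac_self frac_scale[OF I]] star_self[OF S] star_scale[OF S I] by simp
    then show ?thesis
      using mem_scale_iff[of "inverse x" 1] False one_mem by (simp add: divide_inverse)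
  qed
qed

lemma loc_colon:
  assumes P: "P \<in> max_ideals R" and I: "I \<in> fractional_ideals R"
  shows "r \<in> loc P (colon I x) \<longleftrightarrow> r \<in> loc P R \<and> r * x \<in> loc P I"
proof
  assume "r \<in> loc P (colon I x)"
  then show "r \<in> loc P R \<and> r * x \<in> loc P I"
    unfolding loc_def colon_def by (auto simp: mult.assoc)
next
  assume "r \<in> loc P R \<and> r * x \<in> loc P I"
  then obtain s t where s: "s \<in> R" "s \<notin> P" "s * r \<in> R"
    and t: "t \<in> R" "t \<notin> P" "t * (r * x) \<in> I" unfolding loc_def by blast
  have "(s * t) * r \<in> colon I x"
    using mult_mem[OF t(1) s(3)] frac_mult[OF I s(1) t(3)] unfolding colon_def
    by (simp add: mult_ac)
  then show "r \<in> loc P (colon I x)" using locI[of "s * t"] mult_mem max_prime[OF P] s t by blast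
qed

text \<open>Stability is applied once for each member of \<open>F\<close>. Intersecting with
  \<open>R\<close> keeps the set an ideal when \<open>F\<close> is empty.\<close>

lemma one_mem_star_Inter:
  assumes st: "st \<in> Star_st R" and F: "finite F" "F \<subseteq> max_ideals R" "\<And>P. P \<in> F \<Longrightarrow> 1 \<in> st P"
  shows "R \<inter> \<Inter>F \<in> fractional_ideals R \<and> 1 \<in> st (R \<inter> \<Inter>F)"
  using F
proof (induction F rule: finite_induct)
  case empty
  have "st \<in> Star R" using st unfolding Star_st_def by blast
  then show ?case using frac_self star_self one_mem by auto
next
  case (insert P F)
  then have IH: "R \<inter> \<Inter>F \<in> fractional_ideals R" "1 \<in> st (R \<inter> \<Inter>F)" by auto
  have P: "P \<in> fractional_ideals R" "1 \<in> st P" using max_frac insert.prems by auto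
  have "R \<inter> \<Inter>(insert P F) = P \<inter> (R \<inter> \<Inter>F)" by auto
  then show ?case using frac_Int[OF P(1) IH(1)] stable_Int[OF st P(1) IH(1)] IH(2) P(2) by simp
qed

text \<open>\<open>contraction P x\<close> is \<open>x R\<^sub>P \<inter> R\<close>, for \<open>x \<noteq> 0\<close>.\<close>

definition contraction :: "'a set \<Rightarrow> 'a \<Rightarrow> 'a set" where
  "contraction P x = {y \<in> R. y / x \<in> loc P R}"

lemma contraction_frac:
  assumes P: "P \<in> max_ideals R"
  shows "contraction P x \<in> fractional_ideals R"
proof (rule fractionalI[of _ 1])
  show "0 \<in> contraction P x" using zero_mem loc_extensive[OF P, of R] by (auto simp: contraction_def)
  show "y + z \<in> contraction P x" if "y \<in> contraction P x" "z \<in> contraction P x" for y z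
    using that add_mem loc_add[OF P frac_self] unfolding contraction_def by (simp add: add_divide_distrib)
  show "r * y \<in> contraction P x" if "r \<in> R" "y \<in> contraction P x" for r y
    using that mult_mem loc_mult[OF P frac_self, of r "y / x"] loc_extensive[OF P, of R]
    unfolding contraction_def by auto
qed (auto simp: contraction_def one_mem)

lemma contraction_subset:
  assumes P: "P \<in> max_ideals R" and x: "x \<in> P" "x \<noteq> 0"
  shows "contraction P x \<subseteq> P"
proof
  fix y assume y: "y \<in> contraction P x"
  then have "y / x * x \<in> loc P P"
    using loc_mult[OF P max_frac[OF P]] loc_extensive[OF P, of P] x unfolding contraction_def by blast
  then obtain s where "s \<in> R" "s \<notin> P" "s * y \<in> P" using x(2) unfolding loc_def by auto
  then show "y \<in> P" using max_prime[OF P] y unfolding contraction_def by blast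
qed

end

section \<open>Local finiteness and invertible contractions\<close>

locale prufer_locally_finite = prufer +
  assumes finite_character: "x \<in> R \<Longrightarrow> x \<noteq> 0 \<Longrightarrow> finite {P \<in> max_ideals R. x \<in> P}"
begin

text \<open>If \<open>P\<close> is the only maximal ideal containing \<open>x R\<^sub>P \<inter> R\<close>, that ideal is generated by \<open>x\<close> and an
  element outside the other maximal ideals containing \<open>x\<close>; it is therefore invertible.\<close>

lemma star_contraction:
  assumes st: "st \<in> Star R" and P: "P \<in> max_ideals R" and x: "x \<in> P" "x \<noteq> 0"
    and other: "\<And>Q. Q \<in> max_ideals R \<Longrightarrow> Q \<noteq> P \<Longrightarrow> \<not> contraction P x \<subseteq> Q"
  shows "st (contraction P x) \<subseteq> contraction P x"
proof
  let ?J = "contraction P x"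
  note fJ = contraction_frac[OF P, of x]
  have xR: "x \<in> R" using max_subset[OF P] x by blast
  have xJ: "x \<in> ?J" using xR x(2) one_mem loc_extensive[OF P, of R] unfolding contraction_def by auto
  have JR: "?J \<subseteq> R" unfolding contraction_def by blast
  \<comment> \<open>By local finiteness only finitely many ideals have to be avoided; afterwards
    \<open>P\<close> is the only maximal ideal that contains both \<open>x\<close> and
    \<open>c\<close>.\<close>
  have "finite ({Q \<in> max_ideals R. x \<in> Q} - {P})" using finite_character[OF xR x(2)] by simp
  then obtain c where c: "c \<in> ?J" "\<And>Q. Q \<in> max_ideals R \<Longrightarrow> x \<in> Q \<Longrightarrow> Q \<noteq> P \<Longrightarrow> c \<notin> Q"
    using prime_avoidance[OF fJ JR, of "{Q \<in> max_ideals R. x \<in> Q} - {P}"] other by blast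
  have cR: "c \<in> R" using c(1) JR by blast
  obtain u v where uv: "x * u + c * v = 1" "x * u \<in> R" "x * v \<in> R" "c * u \<in> R" "c * v \<in> R"
    using two_generated[OF xR cR x(2)] by blast
  \<comment> \<open>\<open>w\<close> stands for an element of the inverse of (x, c). That it maps
    the contraction into \<open>R\<close> is checked locally: at \<open>P\<close> through
    \<open>y / x\<close>, elsewhere with \<open>x\<close> or \<open>c\<close> as
    denominator.\<close>
  have uJ: "w * y \<in> R" if w: "x * w \<in> R" "c * w \<in> R" and y: "y \<in> ?J" for w y
  proof (rule local_global[OF frac_self])
    fix Q assume Q: "Q \<in> max_ideals R"
    have yR: "y \<in> R" using y JR by blast
    consider "Q = P" | "x \<notin> Q" | "c \<notin> Q" using c(2) Q by blast
    then show "w * y \<in> loc Q R"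
    proof cases
      case 1
      have "(x * w) * (y / x) \<in> loc P R"
        using loc_mult[OF P frac_self] w y loc_extensive[OF P, of R] unfolding contraction_def by blast
      then show ?thesis using 1 x(2) by simp
    next
      case 2
      have "x * (w * y) \<in> R" using mult_mem[OF w(1) yR] by (simp add: mult.assoc)
      then show ?thesis using locI[OF xR 2] by blast
    next
      case 3
      have "c * (w * y) \<in> R" using mult_mem[OF w(2) yR] by (simp add: mult.assoc)
      then show ?thesis using locI[OF cR 3] by blast
    qed
  qed
  have ust: "w * y \<in> R" if w: "x * w \<in> R" "c * w \<in> R" and y: "y \<in> st ?J" for w y
  proof -
    have "(*) w ` ?J \<subseteq> R" using uJ[OF w] by blast
    then have "(*) w ` st ?J \<subseteq> R"
      using star_mono[OF st frac_scale[OF fJ] frac_self] star_self[OF st] star_scale[OF st fJ] by metis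
    then show ?thesis using y by blast
  qed
  fix y assume y: "y \<in> st ?J"
  \<comment> \<open>Expanding by 1 = x u + c v exhibits \<open>y\<close> as a combination of
    \<open>x\<close> and \<open>c\<close> whose coefficients lie in \<open>R\<close> by
    \<open>ust\<close>.\<close>
  have "y = (x * u + c * v) * y" using uv(1) by simp
  also have "\<dots> = (u * y) * x + (v * y) * c" by (simp add: algebra_simps)
  also have "\<dots> \<in> ?J"
    using frac_add[OF fJ frac_mult[OF fJ ust[OF uv(2,4) y] xJ] frac_mult[OF fJ ust[OF uv(3,5) y] c(1)]] .
  finally show "y \<in> ?J" .
qed

text \<open>If some \<open>z \<in> P\<close> were outside \<open>loc P I\<close>, then
  \<open>I\<close> would lie in a closed proper contraction, which contradicts
  \<open>1 \<in> st I\<close>.\<close>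

lemma max_subset_loc:
  assumes st: "st \<in> Star R" and I: "I \<in> fractional_ideals R" "I \<subseteq> R" "I \<noteq> {0}" "1 \<in> st I"
    and P: "P \<in> max_ideals R"
  shows "P \<subseteq> loc P I"
proof (rule ccontr)
  assume "\<not> ?thesis"
  then obtain z where z: "z \<in> P" "z \<notin> loc P I" by blast
  interpret L: valuation_domain "loc P R" by (rule loc_valuation[OF P])
  note fL = loc_frac[OF P I(1)]
  obtain i where i: "i \<in> I" "i \<noteq> 0" using I(3) frac_zero[OF I(1)] by blast
  \<comment> \<open>A nonzero \<open>i\<close> in \<open>I\<close> makes the maximal ideals above
    \<open>I\<close> finite in number; \<open>c \<in> P\<close> will avoid all of them but
    \<open>P\<close>.\<close>
  have "finite ({Q \<in> max_ideals R. I \<subseteq> Q} - {P})"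
    by (rule finite_subset[OF _ finite_character[of i]]) (use i I(2) in auto)
  then obtain c where c: "c \<in> P" "\<And>Q. Q \<in> max_ideals R \<Longrightarrow> I \<subseteq> Q \<Longrightarrow> Q \<noteq> P \<Longrightarrow> c \<notin> Q"
    using prime_avoidance[OF max_frac[OF P] max_subset[OF P], of "{Q \<in> max_ideals R. I \<subseteq> Q} - {P}"]
      max_not_subset[OF P] by blast
  have quot: "a / x \<in> loc P R" if x: "x \<notin> loc P I" and a: "a \<in> loc P I" for a x
  proof -
    obtain m where m: "m \<in> L.nonunits" "a = x * m" using L.not_mem_frac[OF fL x a] by blast
    moreover have "x \<noteq> 0" using L.frac_zero[OF fL] x by auto
    ultimately show ?thesis unfolding L.nonunits_def by simp
  qed
  \<comment> \<open>Both \<open>I\<close> and \<open>c\<close> must lie in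
    \<open>contraction P x\<close>: \<open>z\<close> serves if \<open>c \<in> loc P I\<close>,
    otherwise \<open>c\<close> itself does.\<close>
  obtain x where x: "x \<in> P" "x \<notin> loc P I" "c / x \<in> loc P R"
  proof (cases "c \<in> loc P I")
    case True
    then show thesis using that[OF z] quot[OF z(2)] by blast
  next
    case False
    then have "c \<noteq> 0" using L.frac_zero[OF fL] by auto
    then show thesis using that[OF c(1) False] L.one_mem by simp
  qed
  have x0: "x \<noteq> 0" using x(2) L.frac_zero[OF fL] by auto
  let ?J = "contraction P x"
  have cJ: "c \<in> ?J" using x(3) c(1) max_subset[OF P] unfolding contraction_def by blast
  have IJ: "I \<subseteq> ?J" using quot[OF x(2)] loc_extensive[OF P, of I] I(2) unfolding contraction_def by blast
  have "\<not> ?J \<subseteq> Q" if "Q \<in> max_ideals R" "Q \<noteq> P" for Q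
    using c(2)[OF that(1) _ that(2)] cJ IJ by blast
  then have "st ?J \<subseteq> ?J" by (rule star_contraction[OF st P x(1) x0])
  then have "1 \<in> ?J" using star_mono[OF st I(1) contraction_frac[OF P] IJ] I(4) by blast
  then show False using contraction_subset[OF P x(1) x0] max_one[OF P] by blast
qed

text \<open>A nonzero generator \<open>x\<close> of \<open>loc P P\<close> can be replaced by some
  \<open>s * x \<in> P\<close>, since \<open>s\<close> is a unit of \<open>loc P R\<close>. Then
  \<open>P\<close> is the contraction of this principal ideal, hence closed, so 1 is not in its
  closure. For x = 0 the ideal \<open>P\<close> is zero, which is closed too.\<close>

lemma loc_nonprincipal:
  assumes st: "st \<in> Star R" and P: "P \<in> max_ideals R" and one: "1 \<in> st P"
  shows "loc P P \<noteq> (*) x ` loc P R"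
proof
  assume eq: "loc P P = (*) x ` loc P R"
  have "1 \<in> loc P R" using loc_extensive[OF P, of R] one_mem by blast
  then have "x * 1 \<in> loc P P" unfolding eq by (rule imageI)
  then have "x \<in> loc P P" by simp
  then obtain s where s: "s \<in> R" "s \<notin> P" "s * x \<in> P" unfolding loc_def by blast
  have s0: "s \<noteq> 0" using not_mem_nonzero[OF P] s by blast
  show False
  proof (cases "x = 0")
    case True
    then have "loc P P \<subseteq> {0}" unfolding eq by auto
    then have "P \<subseteq> {0}" using loc_extensive[OF P, of P] by blast
    then have "st P \<subseteq> {0}"
      using star_mono[OF st max_frac[OF P] star_zero(2)[OF st]] star_zero(1)[OF st] by simp
    then show False using one by auto
  next
    case False
    have sx0: "s * x \<noteq> 0" using False s0 by simp
    have inv: "inverse s \<in> loc P R" using s s0 one_mem by (intro locI[of s]) auto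
    have "y \<in> contraction P (s * x)" if y: "y \<in> P" for y
    proof -
      have "y \<in> (*) x ` loc P R" using y eq loc_extensive[OF P, of P] by blast
      then have "y / x \<in> loc P R" unfolding mem_scale_iff[OF False] .
      then have "inverse s * (y / x) \<in> loc P R" by (rule loc_mult[OF P frac_self inv])
      moreover have "inverse s * (y / x) = y / (s * x)" by (simp add: divide_inverse)
      moreover have "y \<in> R" using y max_subset[OF P] by blast
      ultimately show ?thesis unfolding contraction_def by simp
    qed
    then have J: "contraction P (s * x) = P" using contraction_subset[OF P s(3) sx0] by blast
    have "st P \<subseteq> P"
      using star_contraction[OF st P s(3) sx0, unfolded J, OF max_not_subset[OF P]] by blast
    then show False using one max_one[OF P] by blast
  qed
qed

text \<open>Identity or colon operation at \<open>P\<close>, according to whether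
  \<open>1 \<in> st P\<close>; by \<open>one_mem_glue_max\<close> no other choice of this bit can
  glue to \<open>st\<close>.\<close>

definition local_stars :: "('a set \<Rightarrow> 'a set) \<Rightarrow> 'a set \<Rightarrow> 'a set \<Rightarrow> 'a set" where
  "local_stars st P = valuation_domain.local_star (loc P R) (1 \<in> st P)"

lemma local_stars_Star:
  assumes st: "st \<in> Star R" and P: "P \<in> max_ideals R"
  shows "local_stars st P \<in> Star (loc P R)"
  unfolding local_stars_def
  by (rule valuation_domain.local_star_Star[OF loc_valuation[OF P]])
    (use loc_nonprincipal[OF st P] loc_nonunits[OF P] in simp)

lemma local_stars_mem:
  assumes "P \<in> max_ideals R" "I \<in> fractional_ideals R"
  shows "x \<in> local_stars st P (loc P I) \<longleftrightarrow>
    x \<in> loc P I \<or> 1 \<in> st P \<and> (\<forall>m\<in>loc P P. x * m \<in> loc P I)"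
  unfolding local_stars_def
  using valuation_domain.local_star_mem[OF loc_valuation loc_frac] loc_nonunits assms by simp

text \<open>By \<open>stable_mem_iff\<close> the claim becomes one about 1 and the colon ideal
  \<open>A\<close>, whose localizations \<open>loc_colon\<close> computes.\<close>

lemma stable_mem_iff_local:
  assumes st: "st \<in> Star_st R" and I: "I \<in> fractional_ideals R" "I \<noteq> {0}" and x: "x \<noteq> 0"
  shows "x \<in> st I \<longleftrightarrow> (\<forall>P\<in>max_ideals R. x \<in> local_stars st P (loc P I))"
proof -
  have S: "st \<in> Star R" using st unfolding Star_st_def by blast
  define A where "A = colon I x"
  have A: "A \<in> fractional_ideals R" "A \<subseteq> R"
    unfolding A_def using colon_frac[OF I(1)] by (auto simp: colon_def)
  obtain i where i: "i \<in> I" "i \<noteq> 0" using I frac_zero[OF I(1)] by blast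
  \<comment> \<open>Writing \<open>i / x\<close> as a fraction yields a nonzero
    \<open>a \<in> A\<close>; so \<open>A\<close> is not zero and, by local finiteness, lies in
    finitely many maximal ideals.\<close>
  obtain a b where ab: "a \<in> R" "b \<in> R" "b \<noteq> 0" "i / x = a / b" using quotient by blast
  have ax: "a * x = b * i" using ab(3,4) x by (simp add: frac_eq_eq mult.commute)
  have aA: "a \<in> A"
    unfolding A_def colon_def mem_Collect_eq ax by (intro conjI ab(1) frac_mult[OF I(1) ab(2) i(1)])
  have a0: "a \<noteq> 0" using ax ab(3) i(2) x by auto
  have A_loc: "1 \<in> loc P A \<longleftrightarrow> \<not> A \<subseteq> P" if "P \<in> max_ideals R" for P
    using A(2) unfolding loc_def by auto
  have x_loc: "x \<in> loc P I \<longleftrightarrow> 1 \<in> loc P A" if P: "P \<in> max_ideals R" for P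
  proof -
    have "1 \<in> loc P R" using loc_extensive[OF P, of R] one_mem by blast
    then show ?thesis unfolding A_def loc_colon[OF P I(1)] by simp
  qed
  have m_loc: "x * m \<in> loc P I \<longleftrightarrow> m \<in> loc P A" if P: "P \<in> max_ideals R" "m \<in> loc P P" for P m
  proof -
    have "m \<in> loc P R" using P(2) loc_mono[OF max_subset[OF P(1)], of P] by blast
    then show ?thesis unfolding A_def loc_colon[OF P(1) I(1)] by (simp add: mult.commute)
  qed
  have "1 \<in> st A \<longleftrightarrow> (\<forall>P\<in>max_ideals R. x \<in> local_stars st P (loc P I))"
  proof
    assume one: "1 \<in> st A"
    show "\<forall>P\<in>max_ideals R. x \<in> local_stars st P (loc P I)"
    proof
      fix P assume P: "P \<in> max_ideals R"
      show "x \<in> local_stars st P (loc P I)"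
      proof (cases "A \<subseteq> P")
        case False
        then show ?thesis using local_stars_mem[OF P I(1)] x_loc[OF P] A_loc[OF P] by blast
      next
        case True
        \<comment> \<open>Then also \<open>loc P P \<subseteq> loc P A\<close>, that is,
          \<open>x\<close> multiplies \<open>loc P P\<close> into \<open>loc P I\<close>, which is
          the second alternative in \<open>local_stars_mem\<close>.\<close>
        have "P \<subseteq> loc P A" using max_subset_loc[OF S A _ one P] aA a0 by blast
        then have "loc P P \<subseteq> loc P A" by (rule loc_subset[OF P loc_frac[OF P A(1)]])
        moreover have "1 \<in> st P" using star_mono[OF S A(1) max_frac[OF P] True] one by blast
        ultimately show ?thesis using local_stars_mem[OF P I(1)] m_loc[OF P] by blast
      qed
    qed
  next
    assume all: "\<forall>P\<in>max_ideals R. x \<in> local_stars st P (loc P I)"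
    define F where "F = {P \<in> max_ideals R. A \<subseteq> P}"
    have F: "1 \<in> st P \<and> loc P P \<subseteq> loc P A" if "P \<in> F" for P
    proof -
      have P: "P \<in> max_ideals R" "A \<subseteq> P" using that unfolding F_def by auto
      then have "x \<notin> loc P I" using x_loc A_loc by blast
      then have "1 \<in> st P \<and> (\<forall>m\<in>loc P P. x * m \<in> loc P I)"
        using all P(1) local_stars_mem[OF P(1) I(1)] by blast
      then show ?thesis using m_loc[OF P(1)] by blast
    qed
    have finF: "finite F"
      by (rule finite_subset[OF _ finite_character[OF ab(1) a0]]) (use aA in \<open>auto simp: F_def\<close>)
    have "F \<subseteq> max_ideals R" unfolding F_def by blast
    then have B: "R \<inter> \<Inter>F \<in> fractional_ideals R" "1 \<in> st (R \<inter> \<Inter>F)"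
      using one_mem_star_Inter[OF st finF] F by simp_all
    \<comment> \<open>The finite intersection lies in \<open>A\<close>: at P \<in> F because
      \<open>loc P P \<subseteq> loc P A\<close>, at every other \<open>P\<close> because
      \<open>1 \<in> loc P A\<close>.\<close>
    have "b \<in> A" if b: "b \<in> R \<inter> \<Inter>F" for b
    proof (rule local_global[OF A(1)])
      fix P assume P: "P \<in> max_ideals R"
      show "b \<in> loc P A"
      proof (cases "P \<in> F")
        case True
        then show ?thesis using F[OF True] loc_extensive[OF P, of P] b by blast
      next
        case False
        then have "1 \<in> loc P A" using A_loc[OF P] P unfolding F_def by blast
        then show ?thesis using loc_mult[OF P A(1), of b 1] loc_extensive[OF P, of R] b by auto
      qed
    qed
    then show "1 \<in> st A" using star_mono[OF S B(1) A(1)] B(2) by blast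
  qed
  then show ?thesis using stable_mem_iff[OF st I(1)] unfolding A_def by blast
qed

lemma stable_eq_glue:
  assumes st: "st \<in> Star_st R"
  shows "st = glue (local_stars st)"
proof -
  have S: "st \<in> Star R" using st unfolding Star_st_def by blast
  have G: "glue (local_stars st) \<in> Star R" by (rule glue_Star[OF local_stars_Star[OF S]])
  have "x \<in> st I \<longleftrightarrow> x \<in> glue (local_stars st) I" if I: "I \<in> fractional_ideals R" for x I
  proof (cases "x = 0 \<or> I = {0}")
    case True
    then show ?thesis
      using star_zero(1)[OF S] star_zero(1)[OF G] frac_zero[OF star_frac[OF S I]]
        frac_zero[OF star_frac[OF G I]] by auto
  next
    case False
    then show ?thesis using stable_mem_iff_local[OF st I] glue_mem[OF I] by simp
  qed
  then show ?thesis
    by (intro extensionalityI[OF star_extensional[OF S] star_extensional[OF G]]) blast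
qed

lemma bij_betw_glue:
  "bij_betw glue (\<Pi>\<^sub>E P\<in>max_ideals R. Star (loc P R)) (Star_st R)"
proof (rule bij_betw_imageI)
  show "inj_on glue (\<Pi>\<^sub>E P\<in>max_ideals R. Star (loc P R))"
  proof (rule inj_onI)
    fix s t assume s: "s \<in> (\<Pi>\<^sub>E P\<in>max_ideals R. Star (loc P R))"
      and t: "t \<in> (\<Pi>\<^sub>E P\<in>max_ideals R. Star (loc P R))" and eq: "glue s = glue t"
    have sP: "\<And>P. P \<in> max_ideals R \<Longrightarrow> s P \<in> Star (loc P R)"
      and tP: "\<And>P. P \<in> max_ideals R \<Longrightarrow> t P \<in> Star (loc P R)" using s t by auto
    have "star_le R (glue s) (glue t)" "star_le R (glue t) (glue s)"
      unfolding eq star_le_def by auto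
    then have "s P = t P" if "P \<in> max_ideals R" for P
      using glue_le_iff[OF sP tP] glue_le_iff[OF tP sP] that
        frac_domain.star_le_antisym[OF loc_frac_domain sP tP] by blast
    then show "s = t" by (rule PiE_ext[OF s t])
  qed
  show "glue ` (\<Pi>\<^sub>E P\<in>max_ideals R. Star (loc P R)) = Star_st R"
  proof
    show "glue ` (\<Pi>\<^sub>E P\<in>max_ideals R. Star (loc P R)) \<subseteq> Star_st R"
      using glue_stable by auto
    show "Star_st R \<subseteq> glue ` (\<Pi>\<^sub>E P\<in>max_ideals R. Star (loc P R))"
    proof
      fix st assume st: "st \<in> Star_st R"
      then have S: "st \<in> Star R" unfolding Star_st_def by blast
      \<comment> \<open>Members of the product are \<open>undefined\<close> off the maximal ideals,
        hence \<open>restrict\<close>; \<open>glue\<close> reads values at maximal ideals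
        only.\<close>
      have "st = glue (restrict (local_stars st) (max_ideals R))"
        using stable_eq_glue[OF st] unfolding glue_def by (simp cong: INF_cong)
      moreover have "restrict (local_stars st) (max_ideals R) \<in> (\<Pi>\<^sub>E P\<in>max_ideals R. Star (loc P R))"
        using local_stars_Star[OF S] by auto
      ultimately show "st \<in> glue ` (\<Pi>\<^sub>E P\<in>max_ideals R. Star (loc P R))" by blast
    qed
  qed
qed

end

theorem proposition6p11:
  fixes R :: "'a::field set"
  assumes "prufer_domain R"
    and "semilocal R \<or> (locally_finite R \<and> finite_dimensional R)"
  shows "(\<forall>st\<in>Star_st R. \<exists>s. (\<forall>P\<in>max_ideals R. s P \<in> Star (localization R P)) \<and>
            st = (\<lambda>I\<in>fractional_ideals R.
                    \<Inter>P\<in>max_ideals R. s P (ideal_prod quot_field I (localization R P))))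
       \<and> order_isomorphic (Star_st R) (star_le R)
            (local_star_product R) (local_star_product_le R)"
proof -
  interpret prufer R by (rule pruferI[OF assms(1)])
  \<comment> \<open>In the semilocal case there are only finitely many maximal ideals at
    all.\<close>
  have "locally_finite R"
    using assms(2) unfolding semilocal_def locally_finite_def by auto
  then interpret prufer_locally_finite R
    by unfold_locales (simp add: locally_finite_def)
  have prod: "local_star_product R = (\<Pi>\<^sub>E P\<in>max_ideals R. Star (loc P R))"
    unfolding local_star_product_def by (intro PiE_cong) (simp add: localization_eq)
  have glue: "glue s = (\<lambda>I\<in>fractional_ideals R.
      \<Inter>P\<in>max_ideals R. s P (ideal_prod quot_field I (localization R P)))" for s
    unfolding glue_def by (intro restrict_ext INF_cong refl) (simp add: ideal_prod_localization)
  have le: "star_le R (glue s) (glue t) \<longleftrightarrow> local_star_product_le R s t"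
    if "s \<in> local_star_product R" "t \<in> local_star_product R" for s t
  proof -
    have "star_le R (glue s) (glue t) \<longleftrightarrow> (\<forall>P\<in>max_ideals R. star_le (loc P R) (s P) (t P))"
      by (rule glue_le_iff) (use that prod in auto)
    then show ?thesis unfolding local_star_product_le_def by (simp add: localization_eq)
  qed
  have bij: "bij_betw glue (local_star_product R) (Star_st R)"
    unfolding prod by (rule bij_betw_glue)
  \<comment> \<open>The isomorphism sends an operation to its family of local components, so it is
    the inverse of \<open>glue\<close>.\<close>
  define h where "h = inv_into (local_star_product R) glue"
  have h: "bij_betw h (Star_st R) (local_star_product R)"
    unfolding h_def by (rule bij_betw_inv_into[OF bij])
  have gh: "glue (h st) = st" if "st \<in> Star_st R" for st
    unfolding h_def by (rule bij_betw_inv_into_right[OF bij that])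
  have "star_le R st st' \<longleftrightarrow> local_star_product_le R (h st) (h st')"
    if "st \<in> Star_st R" "st' \<in> Star_st R" for st st'
    using le[of "h st" "h st'"] gh that bij_betwE[OF h] by simp
  then have "order_isomorphic (Star_st R) (star_le R) (local_star_product R) (local_star_product_le R)"
    unfolding order_isomorphic_def using h by blast
  moreover have "\<exists>s. (\<forall>P\<in>max_ideals R. s P \<in> Star (localization R P)) \<and>
      st = (\<lambda>I\<in>fractional_ideals R.
              \<Inter>P\<in>max_ideals R. s P (ideal_prod quot_field I (localization R P)))"
    if st: "st \<in> Star_st R" for st
  proof (intro exI[of _ "h st"] conjI ballI)
    show "h st P \<in> Star (localization R P)" if "P \<in> max_ideals R" for P
      using bij_betwE[OF h] st that unfolding local_star_product_def by auto
    show "st = (\<lambda>I\<in>fractional_ideals R.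
        \<Inter>P\<in>max_ideals R. h st P (ideal_prod quot_field I (localization R P)))"
      using gh[OF st] glue[of "h st"] by simp
  qed
  ultimately show ?thesis by blast
qed

end
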